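(* Let $\boldsymbol\beta=\{\beta_j\}_{j\ge 0}$ be a non-increasing weight sequence, and let $\mathcal U,\mathcal Y$ be Hilbert spaces. A function $S:\mathbb D\to\mathcal L(\mathcal U,\mathcal Y)$ belongs to $\mathcal S_{\boldsymbol\beta}(\mathcal U,\mathcal Y)$ (i.e. is a contractive multiplier from $H^2(\mathcal U)$ to $H^2_{\boldsymbol\beta}(\mathcal Y)$) if and only if there is a function $\mathbf S$ in the Schur class $\mathcal S(\mathcal U,\ell_2(\mathcal Y))$ such that $$S(z)=\Psi_{\boldsymbol\beta}(z)\,\mathbf S(z)\qquad\text{for all } z\in\mathbb D.$$
   Context: $\mathbb D$ is the open unit disk; $\mathcal L(\mathcal U,\mathcal Y)$ is the space of bounded linear operators between Hilbert spaces. A weight sequence is a sequence $\boldsymbol\beta=\{\beta_j\}_{j\ge0}$ of positive numbers with $\beta_0=1$ and $\liminf_j\beta_j^{1/j}\ge 1$. For a Hilbert space $\mathcal Y$, the weighted Hardy space $H^2_{\boldsymbol\beta}(\mathcal Y)$ is the Hilbert space of $\mathcal Y$-valued power series $f(z)=\sum_{k\ge0}f_kz^k$ with $\|f\|^2=\sum_{k\ge0}\beta_k\|f_k\|_{\mathcal Y}^2<\infty$ (these are analytic on $\mathbb D$); $H^2(\mathcal U)$ is the classical case of all weights equal to $1$. $\mathcal S_{\boldsymbol\beta}(\mathcal U,\mathcal Y)$ is the set of $\mathcal L(\mathcal U,\mathcal Y)$-valued functions $S$ on $\mathbb D$ such that $M_S:f\mapsto Sf$ is a contraction from $H^2(\mathcal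 U)$ to $H^2_{\boldsymbol\beta}(\mathcal Y)$. The Schur class $\mathcal S(\mathcal U,\mathcal G)$ is the set of analytic functions on $\mathbb D$ whose values are contractive operators from $\mathcal U$ to $\mathcal G$. For non-increasing $\boldsymbol\beta$, set $\gamma_0^{-1}=1$ and $\gamma_j^{-1}=\beta_j^{-1}-\beta_{j-1}^{-1}\ge 0$ for $j\ge1$ (read as $0$ when $\beta_j=\beta_{j-1}$). The operator-valued function $\Psi_{\boldsymbol\beta}:\mathbb D\to\mathcal L(\ell_2(\mathcal Y),\mathcal Y)$ is $$\Psi_{\boldsymbol\beta}(z):\{y_j\}_{j\ge0}\mapsto y_0+\sum_{j=1}^\infty\sqrt{\beta_j^{-1}-\beta_{j-1}^{-1}}\;y_jz^j=\sum_{j=0}^\infty\gamma_j^{-1/2}y_jz^j.$$ *)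

theory Defs
  imports "HOL-Analysis.Analysis"
begin

section \<open>Complex normed spaces and complex Hilbert spaces\<close>

class scaleC = scaleR +
  fixes scaleC :: "complex \<Rightarrow> 'a \<Rightarrow> 'a"  (infixr \<open>*\<^sub>C\<close> 75)
  assumes scaleR_scaleC: "scaleR r x = scaleC (complex_of_real r) x"

class complex_vector = scaleC + real_vector +
  assumes scaleC_add_right: "a *\<^sub>C (x + y) = a *\<^sub>C x + a *\<^sub>C y"
    and scaleC_add_left: "(a + b) *\<^sub>C x = a *\<^sub>C x + b *\<^sub>C x"
    and scaleC_scaleC [simp]: "a *\<^sub>C b *\<^sub>C x = (a * b) *\<^sub>C x"
    and scaleC_one [simp]: "1 *\<^sub>C x = x"

class complex_normed_vector = complex_vector + real_normed_vector +
  assumes norm_scaleC [simp]: "norm (a *\<^sub>C x) = cmod a * norm x"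

text \<open>
  The inner product \<open>cinner\<close> is linear in its first argument.  The real inner product of
  the underlying real space is its real part, so that the norm is the usual one and positive
  definiteness is inherited from \<^class>\<open>real_inner\<close>.
\<close>

class complex_inner = complex_vector + real_inner +
  fixes cinner :: "'a \<Rightarrow> 'a \<Rightarrow> complex"
  assumes cinner_commute: "cinner x y = cnj (cinner y x)"
    and cinner_add_left: "cinner (x + y) z = cinner x z + cinner y z"
    and cinner_scaleC_left: "cinner (a *\<^sub>C x) y = a * cinner x y"
    and inner_eq_Re_cinner: "inner x y = Re (cinner x y)"
begin

lemma cinner_self: "cinner x x = complex_of_real ((norm x)\<^sup>2)"
proof -
  have "Im (cinner x x) = 0"
    using arg_cong[OF cinner_commute[of x x], of Im] by simp
  then show ?thesis
    by (simp add: complex_eq_iff norm_eq_sqrt_inner inner_eq_Re_cinner[symmetric])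
qed

subclass complex_normed_vector
proof
  fix a x
  have "cinner (a *\<^sub>C x) (a *\<^sub>C x) = a * cnj a * cinner x x"
    by (metis cinner_commute cinner_scaleC_left complex_cnj_mult mult.assoc mult.left_commute)
  also have "\<dots> = complex_of_real ((cmod a)\<^sup>2 * (norm x)\<^sup>2)"
    by (simp add: cinner_self complex_norm_square[symmetric])
  finally have "(norm (a *\<^sub>C x))\<^sup>2 = (cmod a * norm x)\<^sup>2"
    by (simp only: cinner_self of_real_eq_iff power_mult_distrib)
  moreover have "0 \<le> norm (a *\<^sub>C x)" "0 \<le> norm x"
    by (simp_all add: norm_eq_sqrt_inner)
  ultimately show "norm (a *\<^sub>C x) = cmod a * norm x"
    by (simp add: power2_eq_iff_nonneg)
qed

end

class chilbert_space = complex_inner + complete_space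

subclass (in chilbert_space) banach ..

lemma bounded_linear_scaleC_right:
  "bounded_linear (\<lambda>x::'a::complex_normed_vector. c *\<^sub>C x)"
proof (rule bounded_linear_intro[where K = "cmod c"])
  fix x y :: 'a and r :: real
  show "c *\<^sub>C (x + y) = c *\<^sub>C x + c *\<^sub>C y" by (rule scaleC_add_right)
  show "c *\<^sub>C r *\<^sub>R x = r *\<^sub>R c *\<^sub>C x" by (simp add: scaleR_scaleC mult.commute)
  show "norm (c *\<^sub>C x) \<le> norm x * cmod c" by (simp add: mult.commute)
qed

lemma scaleC_zero_right [simp]: "c *\<^sub>C (0::'a::complex_vector) = 0"
  using scaleC_add_right[of c "0::'a" 0] by simp

lemma scaleC_minus_right: "c *\<^sub>C (- x :: 'a::complex_vector) = - (c *\<^sub>C x)"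
  using scaleC_add_right[of c x "- x"] by (simp add: eq_neg_iff_add_eq_0 add.commute)

lemma scaleC_diff_right: "c *\<^sub>C (x - y :: 'a::complex_vector) = c *\<^sub>C x - c *\<^sub>C y"
  using scaleC_add_right[of c x "- y"] by (simp add: scaleC_minus_right)

instantiation complex :: chilbert_space
begin

definition scaleC_complex :: "complex \<Rightarrow> complex \<Rightarrow> complex" where "scaleC_complex a x = a * x"
definition cinner_complex :: "complex \<Rightarrow> complex \<Rightarrow> complex" where "cinner_complex x y = x * cnj y"

instance
  by standard (auto simp: scaleC_complex_def cinner_complex_def algebra_simps scaleR_conv_of_real
      inner_complex_def)

end


section \<open>Bounded complex-linear operators\<close>

typedef (overloaded) ('a, 'b) cblinfun (\<open>(_ \<Rightarrow>\<^sub>C\<^sub>L /_)\<close> [22, 21] 21) =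
  "{f :: 'a::complex_normed_vector \<Rightarrow> 'b::complex_normed_vector.
      bounded_linear f \<and> (\<forall>c x. f (c *\<^sub>C x) = c *\<^sub>C f x)}"
  morphisms cblinfun_apply CBlinfun
  by (rule exI[where x = "\<lambda>_. 0"]) auto

setup_lifting type_definition_cblinfun

instantiation cblinfun :: (complex_normed_vector, complex_normed_vector) complex_normed_vector
begin

lift_definition norm_cblinfun :: "'a \<Rightarrow>\<^sub>C\<^sub>L 'b \<Rightarrow> real" is onorm .

lift_definition minus_cblinfun :: "'a \<Rightarrow>\<^sub>C\<^sub>L 'b \<Rightarrow> 'a \<Rightarrow>\<^sub>C\<^sub>L 'b \<Rightarrow> 'a \<Rightarrow>\<^sub>C\<^sub>L 'b"
  is "\<lambda>f g x. f x - g x"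
  by (auto intro: bounded_linear_sub simp: scaleC_diff_right)

lift_definition uminus_cblinfun :: "'a \<Rightarrow>\<^sub>C\<^sub>L 'b \<Rightarrow> 'a \<Rightarrow>\<^sub>C\<^sub>L 'b" is "\<lambda>f x. - f x"
  by (auto intro: bounded_linear_minus simp: scaleC_minus_right)

lift_definition zero_cblinfun :: "'a \<Rightarrow>\<^sub>C\<^sub>L 'b" is "\<lambda>x. 0"
  by auto

lift_definition plus_cblinfun :: "'a \<Rightarrow>\<^sub>C\<^sub>L 'b \<Rightarrow> 'a \<Rightarrow>\<^sub>C\<^sub>L 'b \<Rightarrow> 'a \<Rightarrow>\<^sub>C\<^sub>L 'b"
  is "\<lambda>f g x. f x + g x"
  by (auto intro: bounded_linear_add simp: scaleC_add_right)

lift_definition scaleC_cblinfun :: "complex \<Rightarrow> 'a \<Rightarrow>\<^sub>C\<^sub>L 'b \<Rightarrow> 'a \<Rightarrow>\<^sub>C\<^sub>L 'b"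
  is "\<lambda>c f x. c *\<^sub>C f x"
  by (auto intro: bounded_linear_compose[OF bounded_linear_scaleC_right] simp: mult.commute)

definition scaleR_cblinfun :: "real \<Rightarrow> 'a \<Rightarrow>\<^sub>C\<^sub>L 'b \<Rightarrow> 'a \<Rightarrow>\<^sub>C\<^sub>L 'b"
  where "scaleR_cblinfun r f = complex_of_real r *\<^sub>C f"

definition dist_cblinfun :: "'a \<Rightarrow>\<^sub>C\<^sub>L 'b \<Rightarrow> 'a \<Rightarrow>\<^sub>C\<^sub>L 'b \<Rightarrow> real"
  where "dist_cblinfun f g = norm (f - g)"

definition uniformity_cblinfun :: "(('a \<Rightarrow>\<^sub>C\<^sub>L 'b) \<times> ('a \<Rightarrow>\<^sub>C\<^sub>L 'b)) filter"
  where "uniformity_cblinfun = (INF e\<in>{0 <..}. principal {(x, y). dist x y < e})"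

definition open_cblinfun :: "('a \<Rightarrow>\<^sub>C\<^sub>L 'b) set \<Rightarrow> bool"
  where "open_cblinfun S = (\<forall>x\<in>S. \<forall>\<^sub>F (x', y) in uniformity. x' = x \<longrightarrow> y \<in> S)"

definition sgn_cblinfun :: "'a \<Rightarrow>\<^sub>C\<^sub>L 'b \<Rightarrow> 'a \<Rightarrow>\<^sub>C\<^sub>L 'b"
  where "sgn_cblinfun f = scaleR (inverse (norm f)) f"

instance
proof
  fix f g h :: "'a \<Rightarrow>\<^sub>C\<^sub>L 'b" and a b :: complex and r s :: real and S :: "('a \<Rightarrow>\<^sub>C\<^sub>L 'b) set"
  show "r *\<^sub>R f = complex_of_real r *\<^sub>C f" by (rule scaleR_cblinfun_def)
  show "f + g + h = f + (g + h)" by transfer (simp add: add.assoc)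
  show "f + g = g + f" by transfer (simp add: add.commute)
  show "0 + f = f" by transfer simp
  show "- f + f = 0" by transfer simp
  show "f - g = f + - g" by transfer simp
  show sr: "a *\<^sub>C (f + g) = a *\<^sub>C f + a *\<^sub>C g" for a and f g :: "'a \<Rightarrow>\<^sub>C\<^sub>L 'b"
    by (transfer, simp add: scaleC_add_right)
  show sl: "(a + b) *\<^sub>C f = a *\<^sub>C f + b *\<^sub>C f" for a b
    by transfer (simp add: scaleC_add_left)
  show sc: "a *\<^sub>C b *\<^sub>C f = (a * b) *\<^sub>C f" for a b by transfer simp
  show "1 *\<^sub>C f = f" by transfer simp
  then show "1 *\<^sub>R f = f" by (simp add: scaleR_cblinfun_def)
  show "r *\<^sub>R (f + g) = r *\<^sub>R f + r *\<^sub>R g" by (simp add: scaleR_cblinfun_def sr)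
  show "(r + s) *\<^sub>R f = r *\<^sub>R f + s *\<^sub>R f" by (simp add: scaleR_cblinfun_def sl)
  show "r *\<^sub>R s *\<^sub>R f = (r * s) *\<^sub>R f" by (simp add: scaleR_cblinfun_def sc)
  show "sgn f = inverse (norm f) *\<^sub>R f" by (rule sgn_cblinfun_def)
  show "dist f g = norm (f - g)" by (rule dist_cblinfun_def)
  show "(uniformity :: (('a \<Rightarrow>\<^sub>C\<^sub>L 'b) \<times> ('a \<Rightarrow>\<^sub>C\<^sub>L 'b)) filter) =
      (INF e\<in>{0 <..}. principal {(x, y). dist x y < e})"
    by (rule uniformity_cblinfun_def)
  show "open S = (\<forall>x\<in>S. \<forall>\<^sub>F (x', y) in uniformity. x' = x \<longrightarrow> y \<in> S)"
    by (rule open_cblinfun_def)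
  show "(norm f = 0) = (f = 0)" by transfer (auto simp: onorm_eq_0)
  show "norm (f + g) \<le> norm f + norm g" by transfer (auto intro: onorm_triangle)
  show nc: "norm (a *\<^sub>C f) = cmod a * norm f" for a
  proof (transfer fixing: a)
    fix f :: "'a \<Rightarrow> 'b"
    assume "bounded_linear f \<and> (\<forall>c x. f (c *\<^sub>C x) = c *\<^sub>C f x)"
    then have f: "bounded_linear f" by simp
    have af: "bounded_linear (\<lambda>x. a *\<^sub>C f x)"
      by (rule bounded_linear_compose[OF bounded_linear_scaleC_right f])
    show "onorm (\<lambda>x. a *\<^sub>C f x) = cmod a * onorm f"
    proof (rule antisym)
      show "onorm (\<lambda>x. a *\<^sub>C f x) \<le> cmod a * onorm f"
        by (rule onorm_bound)
          (auto simp: onorm_pos_le[OF f] mult.assoc intro: mult_left_mono onorm[OF f])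
      show "cmod a * onorm f \<le> onorm (\<lambda>x. a *\<^sub>C f x)"
      proof (cases "a = 0")
        case False
        have "onorm f \<le> onorm (\<lambda>x. a *\<^sub>C f x) / cmod a"
          by (rule onorm_bound)
            (use onorm[OF af] False in \<open>auto simp: onorm_pos_le[OF af] field_simps\<close>)
        with False show ?thesis by (simp add: field_simps)
      qed (use onorm_pos_le[OF af] in simp)
    qed
  qed
  show "norm (r *\<^sub>R f) = \<bar>r\<bar> * norm f" by (simp add: scaleR_cblinfun_def nc)
qed

end

lift_definition cblinfun_compose ::
  "('b::complex_normed_vector \<Rightarrow>\<^sub>C\<^sub>L 'c::complex_normed_vector) \<Rightarrow>
   ('a::complex_normed_vector \<Rightarrow>\<^sub>C\<^sub>L 'b) \<Rightarrow> ('a \<Rightarrow>\<^sub>C\<^sub>L 'c)"  (infixl \<open>o\<^sub>C\<^sub>L\<close> 67)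
  is "\<lambda>f g x. f (g x)"
  by (auto intro: bounded_linear_compose)


section \<open>The Hilbert space of square-summable sequences\<close>

typedef (overloaded) 'a ell2 = "{y :: nat \<Rightarrow> 'a::chilbert_space. summable (\<lambda>j. (norm (y j))\<^sup>2)}"
  morphisms ell2_nth Ell2
  by (rule exI[where x = "\<lambda>_. 0"]) auto

setup_lifting type_definition_ell2

lemma summable_sq_add:
  fixes x y :: "nat \<Rightarrow> 'a::real_normed_vector"
  assumes "summable (\<lambda>j. (norm (x j))\<^sup>2)" "summable (\<lambda>j. (norm (y j))\<^sup>2)"
  shows "summable (\<lambda>j. (norm (x j + y j))\<^sup>2)"
proof (rule summable_comparison_test')
  show "summable (\<lambda>j. 2 * (norm (x j))\<^sup>2 + 2 * (norm (y j))\<^sup>2)"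
    by (intro summable_add summable_mult assms)
  fix j
  have "(norm (x j + y j))\<^sup>2 \<le> (norm (x j) + norm (y j))\<^sup>2"
    by (intro power_mono norm_triangle_ineq) auto
  also have "\<dots> \<le> 2 * (norm (x j))\<^sup>2 + 2 * (norm (y j))\<^sup>2"
    using sum_squares_bound[of "norm (x j)" "norm (y j)"] by (simp add: power2_sum)
  finally show "norm ((norm (x j + y j))\<^sup>2) \<le> 2 * (norm (x j))\<^sup>2 + 2 * (norm (y j))\<^sup>2"
    by simp
qed

lemma norm_cinner_le: "cmod (cinner x y) \<le> norm x * norm (y::'a::complex_inner)"
proof (cases "cinner x y = 0")
  case False
  define a where "a = cnj (sgn (cinner x y))"
  have "complex_of_real (cmod (cinner x y)) = a * cinner x y"
    using False
    by (simp add: a_def sgn_eq complex_norm_square[symmetric] power2_eq_square field_simps)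
  also have "\<dots> = cinner (a *\<^sub>C x) y" by (simp add: cinner_scaleC_left)
  finally have "cmod (cinner x y) = inner (a *\<^sub>C x) y"
    by (simp add: inner_eq_Re_cinner) (metis Re_complex_of_real)
  also have "\<dots> \<le> norm (a *\<^sub>C x) * norm y" by (rule norm_cauchy_schwarz)
  also have "\<dots> = norm x * norm y" using False by (simp add: a_def norm_sgn)
  finally show ?thesis .
qed simp

lemma summable_cinner:
  fixes x y :: "nat \<Rightarrow> 'a::complex_inner"
  assumes "summable (\<lambda>j. (norm (x j))\<^sup>2)" "summable (\<lambda>j. (norm (y j))\<^sup>2)"
  shows "summable (\<lambda>j. cinner (x j) (y j))"
proof (rule summable_comparison_test')
  show "summable (\<lambda>j. (norm (x j))\<^sup>2 + (norm (y j))\<^sup>2)"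
    by (intro summable_add assms)
  fix j
  have "cmod (cinner (x j) (y j)) \<le> norm (x j) * norm (y j)" by (rule norm_cinner_le)
  also have "\<dots> \<le> (norm (x j))\<^sup>2 + (norm (y j))\<^sup>2"
    using sum_squares_bound[of "norm (x j)" "norm (y j)"]
      mult_nonneg_nonneg[of "norm (x j)" "norm (y j)"] norm_ge_zero[of "x j"] norm_ge_zero[of "y j"]
    by linarith
  finally show "cmod (cinner (x j) (y j)) \<le> (norm (x j))\<^sup>2 + (norm (y j))\<^sup>2" .
qed

lemma ell2_summable: "summable (\<lambda>j. (norm (ell2_nth x j))\<^sup>2)"
  by transfer simp

instantiation ell2 :: (chilbert_space) complex_inner
begin

lift_definition zero_ell2 :: "'a ell2" is "\<lambda>_. 0" by simp

lift_definition plus_ell2 :: "'a ell2 \<Rightarrow> 'a ell2 \<Rightarrow> 'a ell2" is "\<lambda>x y j. x j + y j"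
  by (rule summable_sq_add)

lift_definition uminus_ell2 :: "'a ell2 \<Rightarrow> 'a ell2" is "\<lambda>x j. - x j" by simp

lift_definition minus_ell2 :: "'a ell2 \<Rightarrow> 'a ell2 \<Rightarrow> 'a ell2" is "\<lambda>x y j. x j - y j"
  using summable_sq_add[where y = "\<lambda>j. - y j" for y] by force

lift_definition scaleC_ell2 :: "complex \<Rightarrow> 'a ell2 \<Rightarrow> 'a ell2" is "\<lambda>c x j. c *\<^sub>C x j"
  by (simp add: power_mult_distrib summable_mult)

definition scaleR_ell2 :: "real \<Rightarrow> 'a ell2 \<Rightarrow> 'a ell2"
  where "scaleR_ell2 r x = complex_of_real r *\<^sub>C x"

definition cinner_ell2 :: "'a ell2 \<Rightarrow> 'a ell2 \<Rightarrow> complex"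
  where "cinner_ell2 x y = (\<Sum>j. cinner (ell2_nth x j) (ell2_nth y j))"

definition inner_ell2 :: "'a ell2 \<Rightarrow> 'a ell2 \<Rightarrow> real"
  where "inner_ell2 x y = Re (cinner x y)"

definition norm_ell2 :: "'a ell2 \<Rightarrow> real"
  where "norm_ell2 x = sqrt (\<Sum>j. (norm (ell2_nth x j))\<^sup>2)"

definition dist_ell2 :: "'a ell2 \<Rightarrow> 'a ell2 \<Rightarrow> real"
  where "dist_ell2 x y = norm (x - y)"

definition uniformity_ell2 :: "('a ell2 \<times> 'a ell2) filter"
  where "uniformity_ell2 = (INF e\<in>{0 <..}. principal {(x, y). dist x y < e})"

definition open_ell2 :: "'a ell2 set \<Rightarrow> bool"
  where "open_ell2 S = (\<forall>x\<in>S. \<forall>\<^sub>F (x', y) in uniformity. x' = x \<longrightarrow> y \<in> S)"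

definition sgn_ell2 :: "'a ell2 \<Rightarrow> 'a ell2"
  where "sgn_ell2 x = scaleR (inverse (norm x)) x"

instance
proof
  fix x y z :: "'a ell2" and a b :: complex and r s :: real and S :: "'a ell2 set"
  show "r *\<^sub>R x = complex_of_real r *\<^sub>C x" by (rule scaleR_ell2_def)
  show "x + y + z = x + (y + z)" by transfer (simp add: add.assoc)
  show "x + y = y + x" by transfer (simp add: add.commute)
  show "0 + x = x" by transfer simp
  show "- x + x = 0" by transfer simp
  show "x - y = x + - y" by transfer simp
  show sr: "a *\<^sub>C (x + y) = a *\<^sub>C x + a *\<^sub>C y" for a and x y :: "'a ell2"
    by transfer (simp add: scaleC_add_right)
  show sl: "(a + b) *\<^sub>C x = a *\<^sub>C x + b *\<^sub>C x" for a b
    by transfer (simp add: scaleC_add_left)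
  show sc: "a *\<^sub>C b *\<^sub>C x = (a * b) *\<^sub>C x" for a b by transfer simp
  show "1 *\<^sub>C x = x" by transfer simp
  then show "1 *\<^sub>R x = x" by (simp add: scaleR_ell2_def)
  show "r *\<^sub>R (x + y) = r *\<^sub>R x + r *\<^sub>R y" by (simp add: scaleR_ell2_def sr)
  show "(r + s) *\<^sub>R x = r *\<^sub>R x + s *\<^sub>R x" by (simp add: scaleR_ell2_def sl)
  show "r *\<^sub>R s *\<^sub>R x = (r * s) *\<^sub>R x" by (simp add: scaleR_ell2_def sc)
  show "sgn x = inverse (norm x) *\<^sub>R x" by (rule sgn_ell2_def)
  show "dist x y = norm (x - y)" by (rule dist_ell2_def)
  show "(uniformity :: ('a ell2 \<times> 'a ell2) filter) =
      (INF e\<in>{0 <..}. principal {(x, y). dist x y < e})"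
    by (rule uniformity_ell2_def)
  show "open S = (\<forall>x\<in>S. \<forall>\<^sub>F (x', y) in uniformity. x' = x \<longrightarrow> y \<in> S)"
    by (rule open_ell2_def)
  have sm: "summable (\<lambda>j. cinner (ell2_nth x j) (ell2_nth y j))" for x y :: "'a ell2"
    by (intro summable_cinner ell2_summable)
  show cc: "cinner x y = cnj (cinner y x)" for x y :: "'a ell2"
  proof -
    have "(\<lambda>j. cnj (cinner (ell2_nth y j) (ell2_nth x j))) sums cnj (cinner y x)"
      unfolding sums_cnj cinner_ell2_def by (rule summable_sums[OF sm])
    then show ?thesis
      unfolding cinner_ell2_def[of x y] by (simp add: cinner_commute[symmetric] sums_iff)
  qed
  show ca: "cinner (x + y) z = cinner x z + cinner y z"
    unfolding cinner_ell2_def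
    by (simp add: plus_ell2.rep_eq cinner_add_left suminf_add[OF sm sm])
  show cs: "cinner (a *\<^sub>C x) y = a * cinner x y" for a
    unfolding cinner_ell2_def
    by (simp add: scaleC_ell2.rep_eq cinner_scaleC_left suminf_mult[OF sm])
  show "inner x y = Re (cinner x y)" for x y :: "'a ell2" by (rule inner_ell2_def)
  show "inner x y = inner y x" unfolding inner_ell2_def by (subst cc) simp
  show "inner (x + y) z = inner x z + inner y z" by (simp add: inner_ell2_def ca)
  show "inner (r *\<^sub>R x) y = r * inner x y" by (simp add: inner_ell2_def scaleR_ell2_def cs)
  have self: "inner x x = (\<Sum>j. (norm (ell2_nth x j))\<^sup>2)"
  proof -
    have "cinner x x = (\<Sum>j. complex_of_real ((norm (ell2_nth x j))\<^sup>2))"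
      by (simp add: cinner_ell2_def cinner_self)
    also have "\<dots> = complex_of_real (\<Sum>j. (norm (ell2_nth x j))\<^sup>2)"
      by (rule suminf_of_real[OF ell2_summable, symmetric])
    finally show ?thesis by (simp add: inner_ell2_def)
  qed
  show "0 \<le> inner x x" unfolding self by (rule suminf_nonneg[OF ell2_summable]) simp
  show "(inner x x = 0) = (x = 0)"
    unfolding self by (subst suminf_eq_zero_iff[OF ell2_summable]) (simp, transfer, auto)
  show "norm x = sqrt (inner x x)" by (simp add: norm_ell2_def self)
qed

end

lemma norm_ell2_sq: "(norm x)\<^sup>2 = (\<Sum>j. (norm (ell2_nth x j))\<^sup>2)"
  by (simp add: norm_ell2_def suminf_nonneg ell2_summable)

lemma sum_sq_le_norm_ell2: "(\<Sum>j<n. (norm (ell2_nth x j))\<^sup>2) \<le> (norm x)\<^sup>2"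
  unfolding norm_ell2_sq by (rule sum_le_suminf[OF ell2_summable]) auto

lemma norm_ell2_nth_le: "norm (ell2_nth x j) \<le> norm x"
proof -
  have "(norm (ell2_nth x j))\<^sup>2 \<le> (\<Sum>i<Suc j. (norm (ell2_nth x i))\<^sup>2)"
    by (simp add: sum_nonneg)
  also have "\<dots> \<le> (norm x)\<^sup>2" by (rule sum_sq_le_norm_ell2)
  finally show ?thesis by (rule power2_le_imp_le) simp
qed

instance ell2 :: (chilbert_space) chilbert_space
proof
  fix X :: "nat \<Rightarrow> 'a ell2"
  assume X: "Cauchy X"
  have "Cauchy (\<lambda>n. ell2_nth (X n) j)" for j
  proof (rule CauchyI)
    fix e :: real assume "0 < e"
    with X obtain M where M: "\<And>m n. m \<ge> M \<Longrightarrow> n \<ge> M \<Longrightarrow> norm (X m - X n) < e"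
      by (meson CauchyD)
    have "norm (ell2_nth (X m) j - ell2_nth (X n) j) < e" if "m \<ge> M" "n \<ge> M" for m n
      using norm_ell2_nth_le[of "X m - X n" j] M[OF that] by (simp add: minus_ell2.rep_eq)
    then show "\<exists>M. \<forall>m\<ge>M. \<forall>n\<ge>M. norm (ell2_nth (X m) j - ell2_nth (X n) j) < e" by blast
  qed
  then have "\<exists>l. (\<lambda>n. ell2_nth (X n) j) \<longlonglongrightarrow> l" for j
    using Cauchy_convergent convergent_def by blast
  then obtain l where l: "\<And>j. (\<lambda>n. ell2_nth (X n) j) \<longlonglongrightarrow> l j" by metis
  have key: "\<exists>M. \<forall>m\<ge>M. summable (\<lambda>j. (norm (ell2_nth (X m) j - l j))\<^sup>2) \<and>
      (\<Sum>j. (norm (ell2_nth (X m) j - l j))\<^sup>2) \<le> e\<^sup>2" if "0 < e" for e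
  proof -
    from X \<open>0 < e\<close> obtain M where M: "\<And>m n. m \<ge> M \<Longrightarrow> n \<ge> M \<Longrightarrow> norm (X m - X n) < e"
      by (meson CauchyD)
    have bd: "(\<Sum>j<k. (norm (ell2_nth (X m) j - l j))\<^sup>2) \<le> e\<^sup>2" if "m \<ge> M" for m k
    proof (rule LIMSEQ_le_const2)
      show "(\<lambda>n. \<Sum>j<k. (norm (ell2_nth (X m) j - ell2_nth (X n) j))\<^sup>2)
          \<longlonglongrightarrow> (\<Sum>j<k. (norm (ell2_nth (X m) j - l j))\<^sup>2)"
        by (intro tendsto_intros l)
      have "(\<Sum>j<k. (norm (ell2_nth (X m) j - ell2_nth (X n) j))\<^sup>2) \<le> e\<^sup>2" if "n \<ge> M" for n
      proof -
        have "(\<Sum>j<k. (norm (ell2_nth (X m) j - ell2_nth (X n) j))\<^sup>2) \<le> (norm (X m - X n))\<^sup>2"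
          using sum_sq_le_norm_ell2[of "X m - X n" k] by (simp add: minus_ell2.rep_eq)
        also have "\<dots> \<le> e\<^sup>2"
          using M[OF \<open>m \<ge> M\<close> that] by (intro power_mono) auto
        finally show ?thesis .
      qed
      then show "\<exists>N. \<forall>n\<ge>N. (\<Sum>j<k. (norm (ell2_nth (X m) j - ell2_nth (X n) j))\<^sup>2) \<le> e\<^sup>2"
        by blast
    qed
    have "summable (\<lambda>j. (norm (ell2_nth (X m) j - l j))\<^sup>2)" if "m \<ge> M" for m
      by (rule summableI_nonneg_bounded[where x = "e\<^sup>2"]) (use bd[OF that] in auto)
    moreover have "(\<Sum>j. (norm (ell2_nth (X m) j - l j))\<^sup>2) \<le> e\<^sup>2" if "m \<ge> M" for m
      by (rule suminf_le_const[OF calculation[OF that] bd[OF that]])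
    ultimately show ?thesis by blast
  qed
  from key[of 1] obtain M where "summable (\<lambda>j. (norm (ell2_nth (X M) j - l j))\<^sup>2)" by auto
  then have "summable (\<lambda>j. (norm (l j - ell2_nth (X M) j))\<^sup>2)" by (simp add: norm_minus_commute)
  from summable_sq_add[OF this ell2_summable[of "X M"]]
  have L: "ell2_nth (Ell2 l) = l" by (simp add: Ell2_inverse)
  have "X \<longlonglongrightarrow> Ell2 l"
  proof (rule LIMSEQ_I)
    fix r :: real assume "0 < r"
    then obtain M where M: "\<forall>m\<ge>M. (\<Sum>j. (norm (ell2_nth (X m) j - l j))\<^sup>2) \<le> (r/2)\<^sup>2"
      using key[of "r/2"] by auto
    have "norm (X m - Ell2 l) < r" if "m \<ge> M" for m
    proof -
      have "(norm (X m - Ell2 l))\<^sup>2 \<le> (r/2)\<^sup>2"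
        using M that by (simp add: norm_ell2_sq minus_ell2.rep_eq L)
      then have "norm (X m - Ell2 l) \<le> r/2" by (rule power2_le_imp_le) (use \<open>0 < r\<close> in simp)
      with \<open>0 < r\<close> show ?thesis by simp
    qed
    then show "\<exists>no. \<forall>n\<ge>no. norm (X n - Ell2 l) < r" by blast
  qed
  then show "convergent X" by (rule convergentI)
qed


section \<open>Weighted Hardy spaces and contractive multipliers\<close>

definition weight_sequence :: "(nat \<Rightarrow> real) \<Rightarrow> bool" where
  "weight_sequence \<beta> \<longleftrightarrow>
     (\<forall>j. 0 < \<beta> j) \<and> \<beta> 0 = 1 \<and> 1 \<le> liminf (\<lambda>j. ereal (root j (\<beta> j)))"

text \<open>A power series is represented by its sequence of coefficients.\<close>

definition ps_eval :: "(nat \<Rightarrow> 'a::complex_normed_vector) \<Rightarrow> complex \<Rightarrow> 'a" where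
  "ps_eval f z = (\<Sum>k. z ^ k *\<^sub>C f k)"

definition whardy :: "(nat \<Rightarrow> real) \<Rightarrow> (nat \<Rightarrow> 'a::chilbert_space) set" where
  "whardy \<beta> = {f. summable (\<lambda>k. \<beta> k * (norm (f k))\<^sup>2)}"

definition whardy_norm :: "(nat \<Rightarrow> real) \<Rightarrow> (nat \<Rightarrow> 'a::chilbert_space) \<Rightarrow> real" where
  "whardy_norm \<beta> f = sqrt (\<Sum>k. \<beta> k * (norm (f k))\<^sup>2)"

abbreviation hardy :: "(nat \<Rightarrow> 'a::chilbert_space) set" where
  "hardy \<equiv> whardy (\<lambda>_. 1)"

abbreviation hardy_norm :: "(nat \<Rightarrow> 'a::chilbert_space) \<Rightarrow> real" where
  "hardy_norm \<equiv> whardy_norm (\<lambda>_. 1)"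

text \<open>
  Functions on the unit disk are total functions on \<^typ>\<open>complex\<close> whose values outside
  \<^term>\<open>ball (0::complex) 1\<close> are ignored.  In the next definition \<open>g\<close> is the power series
  of the product \<open>M\<^sub>S f\<close>; its coefficients are determined by its values on the disk, so
  \<open>M\<^sub>S\<close> is a well-defined linear map.
\<close>

definition contractive_multipliers ::
  "(nat \<Rightarrow> real) \<Rightarrow> (complex \<Rightarrow> 'u::chilbert_space \<Rightarrow>\<^sub>C\<^sub>L 'y::chilbert_space) set" where
  "contractive_multipliers \<beta> =
     {S. \<forall>f\<in>hardy. \<exists>g\<in>whardy \<beta>.
           (\<forall>z\<in>ball 0 1. ps_eval g z = cblinfun_apply (S z) (ps_eval f z)) \<and>
           whardy_norm \<beta> g \<le> hardy_norm f}"


section \<open>The Schur class\<close>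

text \<open>Complex differentiability, for functions with values in a complex normed space; for
  operator-valued functions this refers to the operator norm.\<close>

definition cdifferentiable_on ::
  "(complex \<Rightarrow> 'a::complex_normed_vector) \<Rightarrow> complex set \<Rightarrow> bool"  (infix \<open>cdifferentiable'_on\<close> 50)
  where "f cdifferentiable_on A \<longleftrightarrow>
    (\<forall>z\<in>A. \<exists>D. (f has_derivative (\<lambda>h. h *\<^sub>C D)) (at z within A))"

definition schur_class :: "(complex \<Rightarrow> 'u::chilbert_space \<Rightarrow>\<^sub>C\<^sub>L 'g::chilbert_space) set" where
  "schur_class = {S. S cdifferentiable_on ball 0 1 \<and> (\<forall>z\<in>ball 0 1. norm (S z) \<le> 1)}"


section \<open>The operator-valued function \<open>\<Psi>\<close>\<close>

definition gamma_inv :: "(nat \<Rightarrow> real) \<Rightarrow> nat \<Rightarrow> real" where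
  "gamma_inv \<beta> j = (if j = 0 then 1 else inverse (\<beta> j) - inverse (\<beta> (j - 1)))"

definition Psi :: "(nat \<Rightarrow> real) \<Rightarrow> complex \<Rightarrow> 'y::chilbert_space ell2 \<Rightarrow>\<^sub>C\<^sub>L 'y" where
  "Psi \<beta> z =
     CBlinfun (\<lambda>y. \<Sum>j. z ^ j *\<^sub>C complex_of_real (sqrt (gamma_inv \<beta> j)) *\<^sub>C ell2_nth y j)"

text \<open>
  The two lemmas \<open>ps_eval_sums\<close> and \<open>Psi_apply\<close> below show that the infinite sums and the
  abstraction function \<^const>\<open>CBlinfun\<close> occurring above are meaningful for weight sequences
  and \<open>z\<close> in the unit disk.
\<close>

lemma summable_power_div_weight:
  assumes "weight_sequence \<beta>" "norm z < (1::real)"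
  shows "summable (\<lambda>k. norm z ^ (2 * k) / \<beta> k)"
proof -
  define q where "q = (norm z)\<^sup>2"
  have q: "0 \<le> q" "q < 1" using assms(2) by (auto simp: q_def power_less_one_iff abs_square_less_1)
  define r where "r = (q + 1) / 2"
  have r: "q < r" "r < 1" "0 < r" using q by (auto simp: r_def)
  have "ereal r < liminf (\<lambda>j. ereal (root j (\<beta> j)))"
    using assms(1) r by (auto simp: weight_sequence_def intro: less_le_trans[of _ 1])
  then have "eventually (\<lambda>j. r < root j (\<beta> j)) sequentially"
    by (auto dest: less_LiminfD)
  then have ev: "eventually (\<lambda>j. norm (norm z ^ (2 * j) / \<beta> j) \<le> (q / r) ^ j) sequentially"
    using eventually_gt_at_top[of 0]
  proof eventually_elim
    case (elim j)
    have pos: "0 < \<beta> j" using assms(1) by (simp add: weight_sequence_def)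
    have "r ^ j \<le> root j (\<beta> j) ^ j" using elim r by (intro power_mono) auto
    also have "\<dots> = \<beta> j" using elim pos by (simp add: real_root_pow_pos2)
    finally have "q ^ j / \<beta> j \<le> q ^ j / r ^ j"
      using r q pos by (intro divide_left_mono) auto
    moreover have "norm z ^ (2 * j) = q ^ j" by (simp add: q_def power_mult)
    ultimately show ?case using pos q by (simp add: power_divide)
  qed
  show ?thesis
    by (rule summable_comparison_test_ev[OF ev]) (use q r in \<open>auto intro: summable_geometric\<close>)
qed

lemma ps_eval_sums:
  fixes f :: "nat \<Rightarrow> 'a::chilbert_space"
  assumes "weight_sequence \<beta>" "f \<in> whardy \<beta>" "z \<in> ball 0 1"
  shows "(\<lambda>k. z ^ k *\<^sub>C f k) sums ps_eval f z"
proof -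
  have "summable (\<lambda>k. norm z ^ (2 * k) / \<beta> k + \<beta> k * (norm (f k))\<^sup>2)"
    using assms by (intro summable_add summable_power_div_weight) (auto simp: whardy_def)
  moreover have "norm (z ^ k *\<^sub>C f k) \<le> norm z ^ (2 * k) / \<beta> k + \<beta> k * (norm (f k))\<^sup>2" for k
  proof -
    have pos: "0 < \<beta> k" using assms(1) by (simp add: weight_sequence_def)
    define a where "a = norm z ^ k / sqrt (\<beta> k)"
    define b where "b = sqrt (\<beta> k) * norm (f k)"
    have ab: "0 \<le> a" "0 \<le> b" using pos by (auto simp: a_def b_def)
    have "norm (z ^ k *\<^sub>C f k) = a * b"
      using pos by (simp add: a_def b_def norm_power)
    also have "\<dots> \<le> a\<^sup>2 + b\<^sup>2"
      using sum_squares_bound[of a b] mult_nonneg_nonneg[OF ab] by linarith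
    also have "\<dots> = norm z ^ (2 * k) / \<beta> k + \<beta> k * (norm (f k))\<^sup>2"
      using pos by (simp add: a_def b_def power_divide power_mult_distrib mult.commute[of 2]
          power_mult)
    finally show ?thesis .
  qed
  ultimately have "summable (\<lambda>k. z ^ k *\<^sub>C f k)"
    by (auto intro: summable_comparison_test')
  then show ?thesis unfolding ps_eval_def by (rule summable_sums)
qed

lemma ell2_functional:
  fixes c :: "nat \<Rightarrow> complex" and y :: "'y::chilbert_space ell2"
  assumes c: "summable (\<lambda>j. (norm (c j))\<^sup>2)"
  shows "summable (\<lambda>j. c j *\<^sub>C ell2_nth y j)" (is ?A)
    and "norm (\<Sum>j. c j *\<^sub>C ell2_nth y j) \<le> norm y * sqrt (\<Sum>j. (norm (c j))\<^sup>2)" (is ?B)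
proof -
  have le: "(\<Sum>j<n. norm (c j *\<^sub>C ell2_nth y j)) \<le> norm y * sqrt (\<Sum>j. (norm (c j))\<^sup>2)" for n
  proof -
    have "(\<Sum>j<n. norm (c j *\<^sub>C ell2_nth y j)) = (\<Sum>j<n. \<bar>norm (c j)\<bar> * \<bar>norm (ell2_nth y j)\<bar>)"
      by simp
    also have "\<dots> \<le> L2_set (\<lambda>j. norm (c j)) {..<n} * L2_set (\<lambda>j. norm (ell2_nth y j)) {..<n}"
      by (rule L2_set_mult_ineq)
    also have "\<dots> \<le> sqrt (\<Sum>j. (norm (c j))\<^sup>2) * norm y"
      unfolding L2_set_def
      by (intro mult_mono real_sqrt_le_mono sum_le_suminf c real_le_lsqrt sum_sq_le_norm_ell2)
        (auto intro!: sum_nonneg suminf_nonneg c)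
    finally show ?thesis by (simp add: mult.commute)
  qed
  have sn: "summable (\<lambda>j. norm (c j *\<^sub>C ell2_nth y j))"
    by (rule summableI_nonneg_bounded[OF _ le]) simp
  show ?A by (rule summable_norm_cancel[OF sn])
  show ?B by (rule order_trans[OF summable_norm[OF sn] suminf_le_const[OF sn le]])
qed

lemma Psi_apply:
  fixes y :: "'y::chilbert_space ell2"
  assumes "weight_sequence \<beta>" "decseq \<beta>" "z \<in> ball 0 1"
  shows "(\<lambda>j. z ^ j *\<^sub>C complex_of_real (sqrt (gamma_inv \<beta> j)) *\<^sub>C ell2_nth y j) sums
    cblinfun_apply (Psi \<beta> z) y"
proof -
  define c where "c j = z ^ j * complex_of_real (sqrt (gamma_inv \<beta> j))" for j
  have pos: "0 < \<beta> j" for j using assms(1) by (simp add: weight_sequence_def)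
  have g: "0 \<le> gamma_inv \<beta> j" "gamma_inv \<beta> j \<le> 1 / \<beta> j" for j
  proof -
    have "\<beta> j \<le> \<beta> (j - 1)" using assms(2) by (rule decseqD) simp
    then have "inverse (\<beta> (j - 1)) \<le> inverse (\<beta> j)" using pos by (intro le_imp_inverse_le)
    then show "0 \<le> gamma_inv \<beta> j" by (simp add: gamma_inv_def)
    show "gamma_inv \<beta> j \<le> 1 / \<beta> j"
      using assms(1) less_imp_le[OF pos[of "j - 1"]]
      by (simp add: gamma_inv_def weight_sequence_def inverse_eq_divide)
  qed
  have c: "summable (\<lambda>j. (norm (c j))\<^sup>2)"
  proof (rule summable_comparison_test')
    show "summable (\<lambda>k. norm z ^ (2 * k) / \<beta> k)"
      using assms by (intro summable_power_div_weight) auto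
    fix j
    have "(norm (c j))\<^sup>2 = norm z ^ (2 * j) * gamma_inv \<beta> j"
      using g(1)[of j]
      by (simp add: c_def norm_mult norm_power power_mult_distrib mult.commute[of 2] power_mult)
    also have "\<dots> \<le> norm z ^ (2 * j) * (1 / \<beta> j)"
      by (intro mult_left_mono g) simp
    finally show "norm ((norm (c j))\<^sup>2) \<le> norm z ^ (2 * j) / \<beta> j" by simp
  qed
  define F where "F = (\<lambda>y::'y ell2. \<Sum>j. c j *\<^sub>C ell2_nth y j)"
  have FC: "F (a *\<^sub>C x) = a *\<^sub>C F x" for a x
  proof -
    have "(\<lambda>j. a *\<^sub>C c j *\<^sub>C ell2_nth x j) sums (a *\<^sub>C F x)"
      unfolding F_def
      by (intro bounded_linear.sums[OF bounded_linear_scaleC_right] summable_sums ell2_functional c)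
    then show ?thesis by (simp add: F_def scaleC_ell2.rep_eq mult.commute sums_iff)
  qed
  have "bounded_linear F"
  proof (rule bounded_linear_intro)
    show "F (x + y) = F x + F y" for x y
      by (simp add: F_def plus_ell2.rep_eq scaleC_add_right suminf_add ell2_functional c)
    show "F (r *\<^sub>R x) = r *\<^sub>R F x" for r x
      by (simp add: scaleR_scaleC FC)
    show "norm (F x) \<le> norm x * sqrt (\<Sum>j. (norm (c j))\<^sup>2)" for x
      unfolding F_def by (rule ell2_functional[OF c])
  qed
  then have "cblinfun_apply (CBlinfun F) = F" by (simp add: CBlinfun_inverse FC)
  moreover have "Psi \<beta> z = CBlinfun F" by (simp add: Psi_def F_def c_def)
  moreover have "(\<lambda>j. c j *\<^sub>C ell2_nth y j) sums F y"
    unfolding F_def by (intro summable_sums ell2_functional c)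
  ultimately show ?thesis by (simp add: c_def)
qed

end

theory Submission
  imports Defs "HOL-Complex_Analysis.Complex_Analysis"
begin

text \<open>
  If \<open>S\<close> is a contractive multiplier, let \<open>Z\<close> be the adjoint of the multiplication operator and
  \<open>R\<^sup>* R = I - Z\<^sup>* Z\<close>. On coefficient sequences rescaled by \<open>sqrt \<beta>\<close>, the adjoint \<open>B\<close> of the weighted
  shift is a contraction because \<open>\<beta>\<close> is non-increasing, and its defect \<open>G\<close> is the diagonal operator with entries
  \<open>sqrt (\<beta>\<^sub>j \<gamma>\<^sub>j\<^sup>-\<^sup>1)\<close>. As \<open>Z\<close> intertwines \<open>B\<close> with the unweighted backward shift,
  \<open>(R (B x), G x) \<mapsto> (R x, (Z x)\<^sub>0)\<close> preserves norms. The adjoint of this lurking isometry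
  extends to a contractive colligation whose transfer function is the Schur function sought; testing against
  the kernel vectors \<open>x = (cnj z\<^sup>j y / sqrt \<beta>\<^sub>j)\<^sub>j\<close>, the eigenvectors of \<open>B\<close>, gives \<open>S = \<Psi> T\<close>.

  Conversely, a Schur function is a contractive multiplier of Hardy spaces (Parseval on the roots of
  unity for the truncated Taylor series), and \<open>\<Psi>\<close> is one from the unweighted to the weighted space by
  the Cauchy-Schwarz inequality, since \<open>\<gamma>\<^sub>0\<^sup>-\<^sup>1 + \<dots> + \<gamma>\<^sub>k\<^sup>-\<^sup>1 = \<beta>\<^sub>k\<^sup>-\<^sup>1\<close>.
\<close>

section \<open>Complex-linear maps and Riesz representation\<close>

text \<open>Complex linearity without continuity: the operators below are built as plain functions,
  and their bounds are supplied separately, often only later.\<close>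

definition clinear :: "('a::complex_vector \<Rightarrow> 'b::complex_vector) \<Rightarrow> bool" where
  "clinear f \<longleftrightarrow> (\<forall>x y. f (x + y) = f x + f y) \<and> (\<forall>c x. f (c *\<^sub>C x) = c *\<^sub>C f x)"

lemma clinearI:
  assumes "\<And>x y. f (x + y) = f x + f y" "\<And>c x. f (c *\<^sub>C x) = c *\<^sub>C f x"
  shows "clinear f"
  using assms by (simp add: clinear_def)

lemma clinear_add: "clinear f \<Longrightarrow> f (x + y) = f x + f y"
  and clinear_scaleC: "clinear f \<Longrightarrow> f (c *\<^sub>C x) = c *\<^sub>C f x"
  by (simp_all add: clinear_def)

lemma clinear_imp_linear: "clinear f \<Longrightarrow> linear f"
  by (rule linearI) (simp_all add: clinear_def scaleR_scaleC)

lemma clinear_zero: "clinear f \<Longrightarrow> f 0 = 0"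
  by (simp add: clinear_imp_linear linear_0)

lemma clinear_diff: "clinear f \<Longrightarrow> f (x - y) = f x - f y"
  by (simp add: clinear_imp_linear linear_diff)

lemma clinear_compose: "clinear f \<Longrightarrow> clinear g \<Longrightarrow> clinear (\<lambda>x. f (g x))"
  by (simp add: clinear_def)

lemma clinear_bounded_linear:
  fixes f :: "'a::complex_normed_vector \<Rightarrow> 'b::complex_normed_vector"
  assumes "clinear f" "\<And>x. norm (f x) \<le> K * norm x"
  shows "bounded_linear f"
  using assms by (intro bounded_linear_intro[where K = K])
    (auto simp: clinear_add clinear_scaleC scaleR_scaleC mult.commute)

lemma cblinfun_clinear: "clinear (cblinfun_apply f)"
  using cblinfun_apply[of f] by (auto simp: clinear_def linear_simps)

lemma norm_cblinfun_apply_le: "norm (cblinfun_apply f x) \<le> norm f * norm x"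
  by transfer (simp add: onorm)

lemma cblinfun_apply_CBlinfun:
  assumes "clinear f" "\<And>x. norm (f x) \<le> K * norm x"
  shows "cblinfun_apply (CBlinfun f) = f"
  using assms by (intro CBlinfun_inverse) (auto intro: clinear_bounded_linear clinear_scaleC)

lemma norm_cblinfun_le:
  assumes "0 \<le> K" "\<And>x. norm (cblinfun_apply f x) \<le> K * norm x"
  shows "norm f \<le> K"
  using assms by transfer (rule onorm_bound)

section \<open>Sesquilinearity and separation properties of \<open>cinner\<close>\<close>

lemma cinner_add_right: "cinner x (y + z) = cinner x y + cinner x z"
  by (metis cinner_commute cinner_add_left complex_cnj_add)

lemma cinner_scaleC_right: "cinner x (a *\<^sub>C y) = cnj a * cinner x y"
  by (metis cinner_commute cinner_scaleC_left complex_cnj_mult)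

lemma clinear_cinner_left: "clinear (\<lambda>x. cinner x y)"
  by (simp add: clinear_def cinner_add_left cinner_scaleC_left scaleC_complex_def)

lemma bounded_linear_cinner_left: "bounded_linear (\<lambda>x. cinner x y)"
  by (rule clinear_bounded_linear[OF clinear_cinner_left, where K = "norm y"])
    (metis norm_cinner_le mult.commute)

text \<open>Multiplying the first argument by \<open>\<i>\<close> turns the imaginary part into a
  real part up to sign, so results proved with the real inner product carry over to
  \<open>cinner\<close>.\<close>

lemma cinner_eqI_inner:
  fixes x y :: "'a::complex_inner" and x' y' :: "'b::complex_inner"
  assumes "inner x y = inner x' y'" "inner (\<i> *\<^sub>C x) y = inner (\<i> *\<^sub>C x') y'"
  shows "cinner x y = cinner x' y'"
  using assms by (simp add: inner_eq_Re_cinner cinner_scaleC_left complex_eq_iff)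

lemma cinner_ext:
  fixes x y :: "'a::complex_inner"
  assumes "\<And>v. cinner x v = cinner y v"
  shows "x = y"
proof -
  have "inner (x - y) (x - y) = 0"
    using assms[of "x - y"] by (simp add: inner_diff_left) (simp add: inner_eq_Re_cinner)
  then show ?thesis by simp
qed

text \<open>The vector \<open>w\<close> is the limit of \<open>E x\<close> along a minimising sequence of the quadratic
  functional \<open>\<parallel>E x\<parallel>\<^sup>2 - 2 \<phi> x\<close>; the parallelogram identity makes such a sequence Cauchy.\<close>

lemma riesz_along:
  fixes E :: "'k::real_vector \<Rightarrow> 'h::{real_inner, complete_space}" and \<phi> :: "'k \<Rightarrow> real"
  assumes E: "linear E" and \<phi>: "linear \<phi>" and bd: "\<And>x. \<bar>\<phi> x\<bar> \<le> C * norm (E x)" and "0 \<le> C"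
  shows "\<exists>w\<in>closure (range E). norm w \<le> C \<and> (\<forall>x. inner (E x) w = \<phi> x)"
proof -
  define q where "q x = (norm (E x))\<^sup>2 - 2 * \<phi> x" for x
  \<comment> \<open>Completing the square: the bound on \<open>\<phi>\<close> gives
    \<open>q x\<close> at least (norm (E x) - C)^2 - C^2.\<close>
  have lower: "- C\<^sup>2 \<le> q x" for x
  proof -
    have "0 \<le> (norm (E x) - C)\<^sup>2" by simp
    then show ?thesis
      using bd[of x] by (simp add: q_def power2_diff algebra_simps)
  qed
  define m where "m = Inf (range q)"
  have bdd: "bdd_below (range q)" using lower by (intro bdd_belowI[where m = "- C\<^sup>2"]) auto
  have m: "m \<le> q x" for x unfolding m_def by (rule cInf_lower[OF _ bdd]) simp
  have "\<exists>x. q x < m + inverse (Suc n)" for n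
    using cInf_lessD[of "range q" "m + inverse (Suc n)"] by (auto simp: m_def)
  then obtain X where X: "\<And>n. q (X n) < m + inverse (Suc n)" by metis
  have q_add: "q (x + t *\<^sub>R y) = q x + 2 * t * (inner (E y) (E x) - \<phi> y) + t\<^sup>2 * (norm (E y))\<^sup>2" for x y t
  proof -
    have "(norm (E x + t *\<^sub>R E y))\<^sup>2 = (norm (E x))\<^sup>2 + 2 * t * inner (E y) (E x) + t\<^sup>2 * (norm (E y))\<^sup>2"
      unfolding power2_norm_eq_inner
      by (simp add: inner_add_left inner_add_right inner_commute power2_eq_square)
    then show ?thesis
      by (simp add: q_def linear_add[OF E] linear_add[OF \<phi>] linear_scale[OF E] linear_scale[OF \<phi>]
          algebra_simps)
  qed
  \<comment> \<open>The parallelogram identity in terms of \<open>q\<close>; the linear part cancels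
    because the midpoint is taken in the domain of \<open>E\<close>. Since \<open>m\<close> bounds
    \<open>q\<close> at the midpoint, near-minimisers have close images.\<close>
  have mid: "(norm (E x - E y))\<^sup>2 = 2 * q x + 2 * q y - 4 * q ((1/2) *\<^sub>R (x + y))" for x y
  proof -
    have "(norm (E x - E y))\<^sup>2 = 2 * (norm (E x))\<^sup>2 + 2 * (norm (E y))\<^sup>2 - (norm (E x + E y))\<^sup>2"
      unfolding power2_norm_eq_inner
      by (simp add: inner_add_left inner_add_right inner_diff_left inner_diff_right inner_commute)
    moreover have "4 * q ((1/2) *\<^sub>R (x + y)) = (norm (E x + E y))\<^sup>2 - 4 * \<phi> x - 4 * \<phi> y"
      by (simp add: q_def linear_add[OF E] linear_add[OF \<phi>] linear_scale[OF E] linear_scale[OF \<phi>]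
          power_divide) (simp add: field_simps)
    ultimately show ?thesis by (simp add: q_def)
  qed
  have dist: "(norm (E (X i) - E (X j)))\<^sup>2 \<le> 2 * inverse (Suc i) + 2 * inverse (Suc j)" for i j
    using mid[of "X i" "X j"] X[of i] X[of j] m[of "(1/2) *\<^sub>R (X i + X j)"] by simp
  have "Cauchy (\<lambda>n. E (X n))"
  proof (rule CauchyI)
    fix e :: real assume "0 < e"
    obtain M where M: "inverse (Suc M) < e\<^sup>2 / 4"
      using reals_Archimedean[of "e\<^sup>2 / 4"] \<open>0 < e\<close> by auto
    have "norm (E (X i) - E (X j)) < e" if "i \<ge> M" "j \<ge> M" for i j
    proof -
      have "inverse (real (Suc i)) \<le> inverse (Suc M)" "inverse (real (Suc j)) \<le> inverse (Suc M)"
        using that by (auto intro!: le_imp_inverse_le)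
      with dist[of i j] M have "(norm (E (X i) - E (X j)))\<^sup>2 < e\<^sup>2" by linarith
      then show ?thesis by (rule power2_less_imp_less) (use \<open>0 < e\<close> in simp)
    qed
    then show "\<exists>M. \<forall>i\<ge>M. \<forall>j\<ge>M. norm (E (X i) - E (X j)) < e" by blast
  qed
  then obtain w where w: "(\<lambda>n. E (X n)) \<longlonglongrightarrow> w"
    using Cauchy_convergent convergent_def by blast
  \<comment> \<open>First-order optimality: perturbing the near-minimiser \<open>X n\<close> by
    \<open>t *\<^sub>R y\<close> can lower \<open>q\<close> by at most the error 1/(n+1), which
    disappears in the limit.\<close>
  have quad: "0 \<le> 2 * t * (inner (E y) w - \<phi> y) + t\<^sup>2 * (norm (E y))\<^sup>2" for y t
  proof (rule LIMSEQ_le_const)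
    show "(\<lambda>n. inverse (real (Suc n)) + (2 * t * (inner (E y) (E (X n)) - \<phi> y) + t\<^sup>2 * (norm (E y))\<^sup>2))
      \<longlonglongrightarrow> 2 * t * (inner (E y) w - \<phi> y) + t\<^sup>2 * (norm (E y))\<^sup>2"
      by (rule tendsto_eq_intros LIMSEQ_inverse_real_of_nat w refl | simp)+
    show "\<exists>N. \<forall>n\<ge>N. 0 \<le> inverse (real (Suc n)) + (2 * t * (inner (E y) (E (X n)) - \<phi> y) + t\<^sup>2 * (norm (E y))\<^sup>2)"
    proof (intro exI allI impI)
      fix n
      show "0 \<le> inverse (real (Suc n)) + (2 * t * (inner (E y) (E (X n)) - \<phi> y) + t\<^sup>2 * (norm (E y))\<^sup>2)"
        using q_add[of "X n" t y] m[of "X n + t *\<^sub>R y"] X[of n] by simp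
    qed
  qed
  have repr: "inner (E y) w = \<phi> y" for y
  proof (cases "norm (E y) = 0")
    case True
    with bd[of y] show ?thesis by simp
  next
    case False
    define d where "d = inner (E y) w - \<phi> y"
    \<comment> \<open>This \<open>t\<close> minimises the quadratic in \<open>quad\<close>; its
      minimum there is negative unless \<open>d\<close> vanishes.\<close>
    have "0 \<le> 2 * (- d / (norm (E y))\<^sup>2) * d + (- d / (norm (E y))\<^sup>2)\<^sup>2 * (norm (E y))\<^sup>2"
      using quad[of "- d / (norm (E y))\<^sup>2" y] by (simp add: d_def)
    also have "\<dots> = - (d\<^sup>2 / (norm (E y))\<^sup>2)"
      using False by (simp add: field_simps power2_eq_square)
    finally have "d\<^sup>2 \<le> 0" using False by (simp add: divide_le_0_iff)
    then show ?thesis by (simp add: d_def)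
  qed
  \<comment> \<open>Testing the representation on \<open>E (X n)\<close> itself and passing to the
    limit turns the bound on \<open>\<phi>\<close> into a bound on \<open>w\<close>.\<close>
  have "inner w w \<le> C * norm w"
  proof (rule LIMSEQ_le)
    show "(\<lambda>n. inner (E (X n)) w) \<longlonglongrightarrow> inner w w" by (intro tendsto_intros w)
    show "(\<lambda>n. C * norm (E (X n))) \<longlonglongrightarrow> C * norm w" by (intro tendsto_intros w)
    show "\<exists>N. \<forall>n\<ge>N. inner (E (X n)) w \<le> C * norm (E (X n))"
      using bd by (auto simp: repr abs_le_iff)
  qed
  then have "norm w * norm w \<le> C * norm w" by (simp add: dot_square_norm power2_eq_square)
  then have "norm w \<le> C"
    using \<open>0 \<le> C\<close> by (cases "w = 0") auto
  moreover have "w \<in> closure (range E)"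
    unfolding closure_sequential by (rule exI[where x = "\<lambda>n. E (X n)"]) (simp add: w)
  ultimately show ?thesis using repr by blast
qed

text \<open>\<open>W\<close> is a contraction with \<open>W\<^sup>* E = F\<close>; for \<open>E = id\<close> it is the adjoint of \<open>F\<close>.\<close>

lemma douglas:
  fixes E :: "'k::complex_vector \<Rightarrow> 'h::chilbert_space" and F :: "'k \<Rightarrow> 'g::complex_inner"
  assumes E: "clinear E" and F: "clinear F" and le: "\<And>x. norm (F x) \<le> norm (E x)"
  obtains W where "clinear W" "\<And>v. norm (W v) \<le> norm v"
    "\<And>x v. cinner (E x) (W v) = cinner (F x) v"
proof -
  define M where "M = closure (range E)"
  \<comment> \<open>For each \<open>v\<close>, the Riesz vector of x -> inner (F x) v along
    \<open>E\<close>. Requiring it to lie in \<open>M\<close> makes it unique, which is what will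
    force \<open>W\<close> to be linear.\<close>
  have "\<exists>w. w \<in> M \<and> norm w \<le> norm v \<and> (\<forall>x. inner (E x) w = inner (F x) v)" for v
  proof -
    have lin: "linear (\<lambda>x. inner (F x) v)"
      by (intro linearI) (simp_all add: clinear_add[OF F] linear_scale[OF clinear_imp_linear[OF F]]
          inner_add_left)
    have bd: "\<bar>inner (F x) v\<bar> \<le> norm v * norm (E x)" for x
      using Cauchy_Schwarz_ineq2[of "F x" v] mult_right_mono[OF le[of x] norm_ge_zero[of v]]
      by (simp add: mult.commute)
    show ?thesis
      using riesz_along[OF clinear_imp_linear[OF E] lin bd norm_ge_zero] unfolding M_def by blast
  qed
  then obtain W where WM: "\<And>v. W v \<in> M" and Wn: "\<And>v. norm (W v) \<le> norm v"
    and W: "\<And>x v. inner (E x) (W v) = inner (F x) v" by metis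
  have W': "cinner (E x) (W v) = cinner (F x) v" for x v
    using W[of x v] W[of "\<i> *\<^sub>C x" v] by (intro cinner_eqI_inner) (simp_all add: clinear_scaleC E F)
  have seqI: "u \<in> M" if "\<forall>n. f n \<in> range E" "f \<longlonglongrightarrow> u" for f u
    unfolding M_def closure_sequential by (rule exI[where x = f], rule conjI[OF that])
  have range_add: "x + y \<in> range E" if "x \<in> range E" "y \<in> range E" for x y
    using that by (auto simp: clinear_add[OF E, symmetric])
  have range_scale: "c *\<^sub>C x \<in> range E" if "x \<in> range E" for c x
    using that by (auto simp: clinear_scaleC[OF E, symmetric])
  have add: "u + v \<in> M" if uv: "u \<in> M" "v \<in> M" for u v
  proof -
    obtain f where f: "\<forall>n. f n \<in> range E" "f \<longlonglongrightarrow> u" using uv(1) unfolding M_def closure_sequential by blast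
    obtain g where g: "\<forall>n. g n \<in> range E" "g \<longlonglongrightarrow> v" using uv(2) unfolding M_def closure_sequential by blast
    have "\<forall>n. f n + g n \<in> range E" using f(1) g(1) range_add by blast
    from seqI[OF this tendsto_add[OF f(2) g(2)]] show ?thesis .
  qed
  have scale: "c *\<^sub>C u \<in> M" if u: "u \<in> M" for c u
  proof -
    obtain f where f: "\<forall>n. f n \<in> range E" "f \<longlonglongrightarrow> u" using u unfolding M_def closure_sequential by blast
    have "\<forall>n. c *\<^sub>C f n \<in> range E" using f(1) range_scale by blast
    from seqI[OF this bounded_linear.tendsto[OF bounded_linear_scaleC_right f(2)]] show ?thesis .
  qed
  \<comment> \<open>The difference lies in \<open>M\<close> and is orthogonal to the range of
    \<open>E\<close>, hence to its own approximants and to itself.\<close>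
  have uniq: "u = v" if "u \<in> M" "v \<in> M" and eq: "\<And>x. inner (E x) u = inner (E x) v" for u v
  proof -
    have "u - v \<in> M"
      using add[OF \<open>u \<in> M\<close> scale[OF \<open>v \<in> M\<close>, of "-1"]]
      by (simp add: scaleR_scaleC[of "-1" v, simplified, symmetric])
    then obtain f where f: "\<forall>n. f n \<in> range E" "f \<longlonglongrightarrow> u - v"
      unfolding M_def closure_sequential by blast
    have "inner (f n) (u - v) = 0" for n
      using spec[OF f(1), of n] eq by (auto simp: inner_diff_right)
    moreover have "(\<lambda>n. inner (f n) (u - v)) \<longlonglongrightarrow> inner (u - v) (u - v)"
      by (intro tendsto_intros f)
    ultimately have "inner (u - v) (u - v) = 0" by (simp add: LIMSEQ_const_iff)
    then show ?thesis by simp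
  qed
  have "clinear W"
  proof (rule clinearI)
    show "W (u + v) = W u + W v" for u v
      by (rule uniq) (auto simp: WM add W inner_add_right)
    show "W (c *\<^sub>C v) = c *\<^sub>C W v" for c v
      by (rule uniq) (auto simp: WM scale W W' inner_eq_Re_cinner cinner_scaleC_right)
  qed
  with Wn W' show thesis using that by blast
qed

text \<open>Iterating \<open>p = p\<^sup>2 + (4 p (1 - p)) / 4\<close>, where \<open>4 p (1 - p)\<close> again lies between 0 and 1, writes \<open>P\<close>
  as a series of squares \<open>4\<^sup>-\<^sup>k Q\<^sub>k\<^sup>2\<close> of polynomials in \<open>P\<close>; no functional calculus is needed.\<close>

lemma clinear_square_root:
  fixes P :: "'h::chilbert_space \<Rightarrow> 'h"
  assumes P: "clinear P" and sym: "\<And>x y. inner (P x) y = inner x (P y)"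
    and le: "\<And>x. (norm (P x))\<^sup>2 \<le> inner (P x) x"
  obtains R :: "'h \<Rightarrow> 'h ell2" where "clinear R" "\<And>x. (norm (R x))\<^sup>2 = inner (P x) x"
proof -
  define Q where "Q = rec_nat P (\<lambda>n q x. 4 *\<^sub>R (q x - q (q x)))"
  have Q_0: "Q 0 = P" by (simp add: Q_def)
  have Q_Suc: "Q (Suc n) x = 4 *\<^sub>R (Q n x - Q n (Q n x))" for n x by (simp add: Q_def)
  have inv: "clinear (Q n) \<and> (\<forall>x y. inner (Q n x) y = inner x (Q n y)) \<and>
      (\<forall>x. (norm (Q n x))\<^sup>2 \<le> inner (Q n x) x)" for n
  proof (induction n)
    case 0
    show ?case unfolding Q_0 using P sym le by blast
  next
    case (Suc n)
    then have lin: "clinear (Q n)" and s: "\<And>x y. inner (Q n x) y = inner x (Q n y)"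
      and l: "\<And>x. (norm (Q n x))\<^sup>2 \<le> inner (Q n x) x" by auto
    have "clinear (Q (Suc n))"
      by (rule clinearI)
        (simp_all add: Q_Suc clinear_add[OF lin] clinear_scaleC[OF lin] scaleR_scaleC
          scaleC_add_right scaleC_diff_right mult.commute)
    moreover have "inner (Q (Suc n) x) y = inner x (Q (Suc n) y)" for x y
      by (simp add: Q_Suc inner_diff_left inner_diff_right s)
    moreover have "(norm (Q (Suc n) x))\<^sup>2 \<le> inner (Q (Suc n) x) x" for x
    proof -
      \<comment> \<open>To show that 4q(1-q) inherits the inequality, the hypothesis on
        \<open>Q n\<close> is applied to x - 2 Q x; this uses the identity 1 - 4q(1-q) =
        (1-2q)^2.\<close>
      define a where "a = Q n x"
      define b where "b = Q n a"
      have Qy: "Q n (x - 2 *\<^sub>R a) = a - 2 *\<^sub>R b"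
        using linear_diff[OF clinear_imp_linear[OF lin], of x "2 *\<^sub>R a"]
          linear_scale[OF clinear_imp_linear[OF lin], of 2 a] by (simp add: a_def b_def)
      have "inner b x = inner a a" by (simp add: b_def s) (simp add: a_def)
      moreover have "(norm (a - 2 *\<^sub>R b))\<^sup>2 \<le> inner (a - 2 *\<^sub>R b) (x - 2 *\<^sub>R a)"
        using l[of "x - 2 *\<^sub>R a"] by (simp add: Qy)
      ultimately have "4 * (norm (a - b))\<^sup>2 \<le> inner (a - b) x"
        by (simp add: power2_norm_eq_inner inner_diff_left inner_diff_right inner_commute[of b a]
            inner_commute[of a x] inner_commute[of b x])
      then show ?thesis by (simp add: Q_Suc a_def[symmetric] b_def[symmetric] power_mult_distrib)
    qed
    ultimately show ?case by simp
  qed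
  have lin: "clinear (Q n)" and l: "(norm (Q n x))\<^sup>2 \<le> inner (Q n x) x"
    and s: "inner (Q n x) y = inner x (Q n y)" for n x y
    using inv[of n] by blast+
  \<comment> \<open>The recursion says that \<open>Q n\<close> is its own square plus a quarter of
    \<open>Q (Suc n)\<close>, so the sum telescopes. The remainder tends to 0 because every
    \<open>Q n\<close> is a contraction.\<close>
  have partial: "(\<Sum>k<n. (norm ((1/2)^k *\<^sub>R Q k x))\<^sup>2) = inner (P x) x - (1/4)^n * inner (Q n x) x" for n x
  proof (induction n)
    case (Suc n)
    have "inner (Q n (Q n x)) x = (norm (Q n x))\<^sup>2" by (simp add: s power2_norm_eq_inner)
    moreover have "((1/2::real)^n)\<^sup>2 = (1/4)^n"
      by (simp add: power2_eq_square flip: power_mult_distrib)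
    ultimately show ?case using Suc by (simp add: Q_Suc inner_diff_left power_mult_distrib algebra_simps)
  qed (simp add: Q_0)
  have sums: "(\<lambda>k. (norm ((1/2)^k *\<^sub>R Q k x))\<^sup>2) sums inner (P x) x" for x
  proof -
    have "\<bar>inner (Q n x) x\<bar> \<le> (norm x)\<^sup>2" for n
    proof -
      have "(norm (Q n x))\<^sup>2 \<le> norm (Q n x) * norm x"
        using l[of n x] norm_cauchy_schwarz[of "Q n x" x] by linarith
      then have "norm (Q n x) \<le> norm x"
        by (cases "Q n x = 0") (simp_all add: power2_eq_square)
      then have "norm (Q n x) * norm x \<le> (norm x)\<^sup>2"
        by (simp add: power2_eq_square mult_right_mono)
      then show ?thesis using Cauchy_Schwarz_ineq2[of "Q n x" x] by linarith
    qed
    then have "(\<lambda>n. (1/4)^n * inner (Q n x) x) \<longlonglongrightarrow> 0"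
      by (intro lim_null_mult_right_bounded[where B = "(norm x)\<^sup>2"] LIMSEQ_realpow_zero) auto
    then have "(\<lambda>n. inner (P x) x - (1/4)^n * inner (Q n x) x) \<longlonglongrightarrow> inner (P x) x - 0"
      by (intro tendsto_intros)
    then show ?thesis unfolding sums_def partial by simp
  qed
  \<comment> \<open>The square root takes values in sequences: the squares are placed in separate
    coordinates instead of being combined into one operator on the space itself. Only the norm of
    \<open>R x\<close> matters later.\<close>
  define R where "R x = Ell2 (\<lambda>k. (1/2)^k *\<^sub>R Q k x)" for x
  have R: "ell2_nth (R x) k = (1/2)^k *\<^sub>R Q k x" for x k
    using sums_summable[OF sums[of x]] by (simp add: R_def Ell2_inverse)
  have "clinear R"
    by (rule clinearI; rule ell2_nth_inject[THEN iffD1]; rule ext)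
      (simp_all add: R plus_ell2.rep_eq scaleC_ell2.rep_eq clinear_add[OF lin] clinear_scaleC[OF lin]
        scaleC_add_right scaleR_scaleC mult.commute)
  moreover have "(norm (R x))\<^sup>2 = inner (P x) x" for x
    unfolding norm_ell2_sq R using sums[of x] by (simp add: sums_iff)
  ultimately show thesis using that by blast
qed

section \<open>Power series with vector coefficients\<close>

text \<open>Pairing the difference with a fixed vector reduces the claim to scalar series, where a
  nonzero coefficient of positive index would make 0 an isolated zero of the zero function.\<close>

lemma power_series_unique:
  fixes a b :: "nat \<Rightarrow> 'a::complex_inner"
  assumes a: "\<And>z. norm z < 1 \<Longrightarrow> (\<lambda>k. z ^ k *\<^sub>C a k) sums F z"
    and b: "\<And>z. norm z < 1 \<Longrightarrow> (\<lambda>k. z ^ k *\<^sub>C b k) sums F z"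
  shows "a = b"
proof (rule ext, rule cinner_ext)
  fix k v
  define c where "c j = cinner (a j) v - cinner (b j) v" for j
  have c: "(\<lambda>j. c j * (z - 0) ^ j) sums 0" if "norm (z - 0) < 1" for z
    using sums_diff[OF bounded_linear.sums[OF bounded_linear_cinner_left a[of z]]
        bounded_linear.sums[OF bounded_linear_cinner_left b[of z]], of v v] that
    by (simp add: c_def cinner_scaleC_left algebra_simps)
  have "c k = 0"
  proof (cases "k = 0")
    case True
    then show ?thesis using c[of 0] by simp
  next
    case False
    show ?thesis
    proof (rule ccontr)
      assume "c k \<noteq> 0"
      then obtain s :: real where s: "0 < s" "\<And>z. z \<in> cball (0::complex) s - {0} \<Longrightarrow> (0::complex) \<noteq> 0"
        using powser_0_nonzero[of 1 0 c "\<lambda>_. 0" k] c False by auto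
      from s(2)[of "of_real s"] s(1) show False by simp
    qed
  qed
  then show "cinner (a k) v = cinner (b k) v" by (simp add: c_def)
qed

lemma bounded_linear_scaleC_left: "bounded_linear (\<lambda>h. h *\<^sub>C (x::'a::complex_normed_vector))"
  by (rule bounded_linear_intro[where K = "norm x"])
    (simp_all add: scaleC_add_left scaleR_scaleC scaleC_complex_def)

text \<open>The terms are those of the twice differentiated geometric series; they majorise
  second-order Taylor remainders of powers.\<close>

lemma summable_second_derivative_geometric:
  fixes K :: real
  assumes "0 \<le> K" "K < 1"
  shows "summable (\<lambda>n. real n * real (n - Suc 0) * K ^ (n - 2))"
proof -
  have s0: "summable (\<lambda>n. (\<lambda>_. 1) n * x ^ n)" if "norm x < 1" for x :: real
    using that by (simp add: summable_geometric)
  have s1: "summable (\<lambda>n. diffs (\<lambda>_. 1) n * x ^ n)" if "norm x < 1" for x :: real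
    using termdiff_converges[OF that s0] .
  have "summable (\<lambda>n. diffs (diffs (\<lambda>_. 1)) n * K ^ n)"
    by (rule termdiff_converges[where K = 1]) (use assms s1 in auto)
  then have "summable (\<lambda>n. real (n + 2) * real (n + 2 - Suc 0) * K ^ (n + 2 - 2))"
    by (simp add: diffs_def mult_ac add_ac)
  then show ?thesis by (rule summable_iff_shift[THEN iffD1])
qed

text \<open>Convergence is assumed only pointwise in \<open>u\<close>, but contractive coefficients
  make the second-order remainder uniform in \<open>u\<close>, so the derivative exists in operator
  norm.\<close>

lemma power_series_cdifferentiable:
  fixes t :: "nat \<Rightarrow> 'u::chilbert_space \<Rightarrow> 'g::chilbert_space" and T :: "complex \<Rightarrow> 'u \<Rightarrow>\<^sub>C\<^sub>L 'g"
  assumes lin: "\<And>k. clinear (t k)" and bd: "\<And>k u. norm (t k u) \<le> norm u"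
    and T: "\<And>z u. norm z < 1 \<Longrightarrow> (\<lambda>k. z ^ k *\<^sub>C t k u) sums cblinfun_apply (T z) u"
  shows "T cdifferentiable_on ball 0 1"
  unfolding cdifferentiable_on_def
proof
  fix z :: complex assume z: "z \<in> ball 0 1"
  \<comment> \<open>A radius strictly between |z| and 1, so that a neighbourhood of \<open>z\<close>
    stays where the majorant converges.\<close>
  define K where "K = (1 + norm z) / 2"
  have K: "norm z < K" "0 \<le> K" "K < 1" using z by (auto simp: K_def)
  \<comment> \<open>The derivative of the k-th power. At k = 0 the truncated exponent is harmless
    because the factor vanishes.\<close>
  define d where "d k = of_nat k * z ^ (k - Suc 0)" for k
  have sd: "summable (\<lambda>k. norm (d k))"
  proof -
    have "summable (\<lambda>n. diffs (\<lambda>_. 1) n * norm z ^ n)"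
      by (rule termdiff_converges[where K = 1]) (use z in \<open>auto simp: summable_geometric\<close>)
    then have "summable (\<lambda>k. norm (d (k + 1)))"
      by (simp add: d_def diffs_def norm_mult norm_power del: of_nat_Suc)
    then show ?thesis by (rule summable_iff_shift[THEN iffD1])
  qed
  define M where "M = (\<Sum>n. real n * real (n - Suc 0) * K ^ (n - 2))"
  have sM: "summable (\<lambda>n. real n * real (n - Suc 0) * K ^ (n - 2))"
    by (rule summable_second_derivative_geometric) (use K in auto)
  have "0 \<le> M" unfolding M_def by (rule suminf_nonneg[OF sM]) (use K in auto)
  define Df where "Df u = (\<Sum>k. d k *\<^sub>C t k u)" for u
  have bound: "norm (d k *\<^sub>C t k u) \<le> norm (d k) * norm u" for k u
    by (simp add: bd mult_left_mono)
  have snD: "summable (\<lambda>k. norm (d k *\<^sub>C t k u))" for u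
    by (rule summable_comparison_test'[OF summable_mult2[OF sd, of "norm u"]]) (use bound in auto)
  have D: "(\<lambda>k. d k *\<^sub>C t k u) sums Df u" for u
    unfolding Df_def by (intro summable_sums summable_norm_cancel[OF snD])
  have "clinear Df"
  proof (rule clinearI)
    show "Df (u + v) = Df u + Df v" for u v
      using sums_add[OF D[of u] D[of v]] D[of "u + v"]
      by (simp add: clinear_add[OF lin] scaleC_add_right sums_iff)
    show "Df (c *\<^sub>C u) = c *\<^sub>C Df u" for c u
      using bounded_linear.sums[OF bounded_linear_scaleC_right D[of u], of c] D[of "c *\<^sub>C u"]
      by (simp add: clinear_scaleC[OF lin] mult.commute sums_iff)
  qed
  moreover have "norm (Df u) \<le> (\<Sum>k. norm (d k)) * norm u" for u
  proof -
    have "norm (Df u) \<le> (\<Sum>k. norm (d k *\<^sub>C t k u))" unfolding Df_def by (rule summable_norm[OF snD])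
    also have "\<dots> \<le> (\<Sum>k. norm (d k) * norm u)"
      by (rule suminf_le[OF bound snD summable_mult2[OF sd]])
    finally show ?thesis by (simp add: suminf_mult2[OF sd])
  qed
  ultimately have D_apply: "cblinfun_apply (CBlinfun Df) = Df"
    by (rule cblinfun_apply_CBlinfun)
  have est: "norm (T y - T z - (y - z) *\<^sub>C CBlinfun Df) / norm (y - z) \<le> M * norm (y - z)"
    if y: "norm (y - z) < K - norm z" "y \<noteq> z" for y
  proof -
    define h where "h = y - z"
    have h: "h \<noteq> 0" "norm (z + h) \<le> K" "y = z + h"
      using y norm_triangle_ineq[of z h] by (auto simp: h_def)
    have pw: "norm ((z + h) ^ k - z ^ k - h * d k) \<le> (real k * real (k - Suc 0) * K ^ (k - 2)) * (norm h)\<^sup>2" for k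
    proof -
      have "(z + h) ^ k - z ^ k - h * d k = h * (((z + h) ^ k - z ^ k) / h - of_nat k * z ^ (k - Suc 0))"
        using h(1) by (simp add: d_def field_simps)
      also have "norm \<dots> \<le> norm h * (real k * real (k - Suc 0) * K ^ (k - 2) * norm h)"
        using lemma_termdiff3[OF h(1) less_imp_le[OF K(1)] h(2), of k]
        by (simp add: norm_mult mult_left_mono)
      finally show ?thesis by (simp add: power2_eq_square mult_ac)
    qed
    have "norm (T y - T z - h *\<^sub>C CBlinfun Df) \<le> M * (norm h)\<^sup>2"
    proof (rule norm_cblinfun_le)
      fix u
      let ?c = "\<lambda>k. (z + h) ^ k - z ^ k - h * d k"
      have "(\<lambda>k. (z + h) ^ k *\<^sub>C t k u - z ^ k *\<^sub>C t k u - h *\<^sub>C d k *\<^sub>C t k u) sums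
          (cblinfun_apply (T y) u - cblinfun_apply (T z) u - h *\<^sub>C Df u)"
        unfolding h(3) using order_le_less_trans[OF h(2) K(3)] z
        by (intro sums_diff T bounded_linear.sums[OF bounded_linear_scaleC_right] D) auto
      moreover have "(z + h) ^ k *\<^sub>C t k u - z ^ k *\<^sub>C t k u - h *\<^sub>C d k *\<^sub>C t k u = ?c k *\<^sub>C t k u" for k
        using scaleC_add_left[of "?c k" "z ^ k + h * d k" "t k u"]
        by (simp add: scaleC_add_left algebra_simps)
      ultimately have S: "(\<lambda>k. ?c k *\<^sub>C t k u) sums
          cblinfun_apply (T y - T z - h *\<^sub>C CBlinfun Df) u"
        by (simp add: minus_cblinfun.rep_eq scaleC_cblinfun.rep_eq D_apply)
      have b: "norm (?c k *\<^sub>C t k u) \<le> (real k * real (k - Suc 0) * K ^ (k - 2)) * ((norm h)\<^sup>2 * norm u)" for k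
        using mult_mono[OF pw[of k] bd[of k u]] K(2) by (simp add: mult_ac)
      have sn: "summable (\<lambda>k. norm (?c k *\<^sub>C t k u))"
        by (rule summable_comparison_test'[OF summable_mult2[OF sM, of "(norm h)\<^sup>2 * norm u"]])
          (use b in auto)
      have "norm (cblinfun_apply (T y - T z - h *\<^sub>C CBlinfun Df) u) \<le> (\<Sum>k. norm (?c k *\<^sub>C t k u))"
        using S summable_norm[OF sn] by (simp add: sums_iff)
      also have "\<dots> \<le> (\<Sum>k. (real k * real (k - Suc 0) * K ^ (k - 2)) * ((norm h)\<^sup>2 * norm u))"
        by (rule suminf_le[OF b sn summable_mult2[OF sM]])
      also have "\<dots> = M * ((norm h)\<^sup>2 * norm u)" unfolding M_def by (rule suminf_mult2[OF sM, symmetric])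
      finally show "norm (cblinfun_apply (T y - T z - h *\<^sub>C CBlinfun Df) u) \<le> M * (norm h)\<^sup>2 * norm u"
        by (simp add: mult_ac)
    qed (use \<open>0 \<le> M\<close> in simp)
    then show ?thesis using h(1) by (simp add: h_def power2_eq_square field_simps)
  qed
  have "(T has_derivative (\<lambda>h. h *\<^sub>C CBlinfun Df)) (at z within ball 0 1)"
    unfolding has_derivative_iff_norm
  proof (intro conjI bounded_linear_scaleC_left)
    have "((\<lambda>y. M * norm (y - z)) \<longlongrightarrow> M * norm (z - z)) (at z within ball 0 1)"
      by (intro tendsto_intros)
    then have lim: "((\<lambda>y. M * norm (y - z)) \<longlongrightarrow> 0) (at z within ball 0 1)" by simp
    have "\<forall>\<^sub>F y in at z within ball 0 1. norm (y - z) < K - norm z \<and> y \<noteq> z"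
      unfolding eventually_at using K by (intro exI[where x = "K - norm z"]) (auto simp: dist_norm)
    then have ev: "\<forall>\<^sub>F y in at z within ball 0 1.
        norm (norm (T y - T z - (y - z) *\<^sub>C CBlinfun Df) / norm (y - z)) \<le> M * norm (y - z)"
      by eventually_elim (use est in auto)
    show "((\<lambda>y. norm (T y - T z - (y - z) *\<^sub>C CBlinfun Df) / norm (y - z)) \<longlongrightarrow> 0) (at z within ball 0 1)"
      by (rule Lim_null_comparison[OF ev lim])
  qed
  then show "\<exists>D. (T has_derivative (\<lambda>h. h *\<^sub>C D)) (at z within ball 0 1)" by blast
qed

section \<open>Direct sums and shifts on sequence spaces\<close>

text \<open>The real Hilbert structure on pairs is inherited; adding the complex one yields the
  direct sums on which colligations act as single operators.\<close>

instantiation prod :: (complex_inner, complex_inner) complex_inner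
begin

definition scaleC_prod :: "complex \<Rightarrow> 'a \<times> 'b \<Rightarrow> 'a \<times> 'b"
  where "scaleC_prod c p = (c *\<^sub>C fst p, c *\<^sub>C snd p)"

definition cinner_prod :: "'a \<times> 'b \<Rightarrow> 'a \<times> 'b \<Rightarrow> complex"
  where "cinner_prod p q = cinner (fst p) (fst q) + cinner (snd p) (snd q)"

instance
proof
  fix p q r :: "'a \<times> 'b" and a b :: complex and s :: real
  show "s *\<^sub>R p = complex_of_real s *\<^sub>C p" by (simp add: scaleC_prod_def prod_eq_iff scaleR_scaleC)
  show "a *\<^sub>C (p + q) = a *\<^sub>C p + a *\<^sub>C q" by (simp add: scaleC_prod_def scaleC_add_right)
  show "(a + b) *\<^sub>C p = a *\<^sub>C p + b *\<^sub>C p" by (simp add: scaleC_prod_def scaleC_add_left)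
  show "a *\<^sub>C b *\<^sub>C p = (a * b) *\<^sub>C p" "1 *\<^sub>C p = p" by (simp_all add: scaleC_prod_def)
  show "cinner p q = cnj (cinner q p)"
    using cinner_commute[of "fst p" "fst q"] cinner_commute[of "snd p" "snd q"]
    by (simp add: cinner_prod_def)
  show "cinner (p + q) r = cinner p r + cinner q r" by (simp add: cinner_prod_def cinner_add_left)
  show "cinner (a *\<^sub>C p) q = a * cinner p q"
    by (simp add: cinner_prod_def scaleC_prod_def cinner_scaleC_left distrib_left)
  show "inner p q = Re (cinner p q)" by (simp add: cinner_prod_def inner_prod_def inner_eq_Re_cinner)
qed

end

instance prod :: (chilbert_space, chilbert_space) chilbert_space ..

lemma cinner_scaleR_left: "cinner (r *\<^sub>R x) y = of_real r * cinner x y"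
  by (simp add: scaleR_scaleC cinner_scaleC_left)

lemma cinner_scaleR_right: "cinner x (r *\<^sub>R y) = of_real r * cinner x y"
  by (simp add: scaleR_scaleC cinner_scaleC_right)

lemma bounded_linear_cinner_right: "bounded_linear (\<lambda>y. cinner x y)"
  by (rule bounded_linear_intro[where K = "norm x"])
    (simp_all add: cinner_add_right cinner_scaleR_right scaleR_conv_of_real norm_cinner_le mult.commute[of "norm _" "norm x"])

lemma cinner_zero [simp]: "cinner 0 (y :: 'a::complex_inner) = 0" "cinner (y :: 'a::complex_inner) 0 = 0"
  using norm_cinner_le[of 0 y] norm_cinner_le[of y 0] by simp_all

lemma cinner_ext_right:
  fixes x y :: "'a::complex_inner"
  assumes "\<And>v. cinner v x = cinner v y"
  shows "x = y"
  using assms by (metis cinner_commute cinner_ext)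

section \<open>Coordinates and shifts on \<open>ell2\<close>\<close>

lemma ell2_eqI: "(\<And>j. ell2_nth x j = ell2_nth y j) \<Longrightarrow> x = y"
  by (simp add: ell2_nth_inject[symmetric] fun_eq_iff)

lemma ell2_nth_Ell2: "summable (\<lambda>j. (norm (x j))\<^sup>2) \<Longrightarrow> ell2_nth (Ell2 x) = x"
  by (simp add: Ell2_inverse)

lemma cinner_ell2_sums: "(\<lambda>j. cinner (ell2_nth x j) (ell2_nth y j)) sums cinner x y"
  unfolding cinner_ell2_def by (intro summable_sums summable_cinner ell2_summable)

lemma norm_ell2_sums: "(\<lambda>j. (norm (ell2_nth x j))\<^sup>2) sums (norm x)\<^sup>2"
  unfolding norm_ell2_sq by (intro summable_sums ell2_summable)

definition ell2_const :: "'a::chilbert_space \<Rightarrow> 'a ell2" where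
  "ell2_const u = Ell2 (\<lambda>j. if j = 0 then u else 0)"

definition ell2_shift :: "'a::chilbert_space ell2 \<Rightarrow> 'a ell2" where
  "ell2_shift f = Ell2 (case_nat 0 (ell2_nth f))"

definition ell2_backshift :: "'a::chilbert_space ell2 \<Rightarrow> 'a ell2" where
  "ell2_backshift f = Ell2 (\<lambda>j. ell2_nth f (Suc j))"

lemma ell2_nth_const: "ell2_nth (ell2_const u) = (\<lambda>j. if j = 0 then u else 0)"
  unfolding ell2_const_def
  by (rule ell2_nth_Ell2) (rule summable_finite[where N = "{0}"], auto)

lemma ell2_nth_shift: "ell2_nth (ell2_shift f) = case_nat 0 (ell2_nth f)"
  unfolding ell2_shift_def
  by (rule ell2_nth_Ell2, subst summable_Suc_iff[symmetric]) (simp add: ell2_summable)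

lemma ell2_nth_backshift: "ell2_nth (ell2_backshift f) = (\<lambda>j. ell2_nth f (Suc j))"
  unfolding ell2_backshift_def
  by (rule ell2_nth_Ell2) (use ell2_summable[of f] in \<open>simp add: summable_Suc_iff[of "\<lambda>j. (norm (ell2_nth f j))\<^sup>2"]\<close>)

lemma cinner_ell2_const: "cinner x (ell2_const u) = cinner (ell2_nth x 0) u"
proof -
  have "(\<lambda>j. cinner (ell2_nth x j) (ell2_nth (ell2_const u) j)) sums (\<Sum>j\<in>{0}. cinner (ell2_nth x j) (ell2_nth (ell2_const u) j))"
    by (rule sums_finite) (auto simp: ell2_nth_const)
  with cinner_ell2_sums[of x "ell2_const u"] show ?thesis
    by (simp add: sums_iff ell2_nth_const)
qed

lemma cinner_ell2_shift: "cinner (ell2_shift f) x = cinner f (ell2_backshift x)"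
proof -
  have "(\<lambda>j. cinner (ell2_nth (ell2_shift f) j) (ell2_nth x j)) sums cinner f (ell2_backshift x)"
    using sums_Suc[of "\<lambda>j. cinner (ell2_nth (ell2_shift f) j) (ell2_nth x j)" "cinner f (ell2_backshift x)"]
      cinner_ell2_sums[of f "ell2_backshift x"]
    by (simp add: ell2_nth_shift ell2_nth_backshift)
  with cinner_ell2_sums[of "ell2_shift f" x] show ?thesis by (simp add: sums_iff)
qed

lemma norm_ell2_backshift: "(norm x)\<^sup>2 = (norm (ell2_nth x 0))\<^sup>2 + (norm (ell2_backshift x))\<^sup>2"
  using sums_Suc[OF norm_ell2_sums[of "ell2_backshift x", unfolded ell2_nth_backshift]] norm_ell2_sums[of x]
  by (simp add: sums_iff)

section \<open>Transfer functions of contractive colligations\<close>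

lemma clinear_fst: "clinear f \<Longrightarrow> clinear (\<lambda>x. fst (f x))"
  and clinear_snd: "clinear f \<Longrightarrow> clinear (\<lambda>x. snd (f x))"
  by (simp_all add: clinear_def scaleC_prod_def)

lemma clinear_Pair: "clinear f \<Longrightarrow> clinear g \<Longrightarrow> clinear (\<lambda>x. (f x, g x))"
  by (simp add: clinear_def scaleC_prod_def)

lemma clinear_ident: "clinear (\<lambda>x. x)" and clinear_const_zero: "clinear (\<lambda>x. 0)"
  by (simp_all add: clinear_def)

text \<open>With \<open>W\<close> written as a block matrix (A, B; C, D), the function is T(z) = D +
  zC(I - zA)^(-1)B, and the state is (I - zA)^(-1)Bu. Contractivity of \<open>W\<close> gives the
  bound on \<open>T\<close> by an energy balance.\<close>

lemma contractive_colligation_transfer_function: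
  fixes W :: "'x::chilbert_space \<times> 'u::chilbert_space \<Rightarrow> 'x \<times> 'g::chilbert_space"
  assumes W: "clinear W" and contr: "\<And>v. norm (W v) \<le> norm v"
  obtains T :: "complex \<Rightarrow> 'u \<Rightarrow>\<^sub>C\<^sub>L 'g" where "T \<in> schur_class"
    "\<And>z u. norm z < 1 \<Longrightarrow> \<exists>\<xi>. W (z *\<^sub>C \<xi>, u) = (\<xi>, cblinfun_apply (T z) u)"
proof -
  \<comment> \<open>In block notation \<open>p 0 u\<close> is (Bu, Du) and
    \<open>p (Suc k) u\<close> is (A^(k+1)Bu, CA^k Bu): the coefficients of state and output
    together.\<close>
  define p where "p = rec_nat (\<lambda>u. W (0, u)) (\<lambda>_ q u. W (fst (q u), 0))"
  have p_0: "p 0 u = W (0, u)" and p_Suc: "p (Suc k) u = W (fst (p k u), 0)" for k u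
    by (simp_all add: p_def)
  have lin: "clinear (p k)" for k
  proof (induction k)
    case 0
    have "clinear (Pair (0::'x) :: 'u \<Rightarrow> 'x \<times> 'u)" by (simp add: clinear_def scaleC_prod_def)
    from clinear_compose[OF W this] show ?case by (simp add: p_def)
  next
    case (Suc k)
    show ?case unfolding p_Suc[abs_def]
      by (intro clinear_compose[OF W] clinear_Pair clinear_fst Suc clinear_const_zero)
  qed
  have bd: "norm (p k u) \<le> norm u" for k u
  proof (induction k)
    case 0
    show ?case using contr[of "(0, u)"] by (simp add: p_0)
  next
    case (Suc k)
    have "norm (p (Suc k) u) \<le> norm (fst (p k u))" using contr[of "(fst (p k u), 0)"] by (simp add: p_Suc)
    also have "\<dots> \<le> norm (p k u)" using norm_fst_le[of "fst (p k u)" "snd (p k u)"] by simp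
    finally show ?case using Suc by simp
  qed
  define \<Phi> where "\<Phi> z u = (\<Sum>k. z ^ k *\<^sub>C p k u)" for z u
  have \<Phi>: "(\<lambda>k. z ^ k *\<^sub>C p k u) sums \<Phi> z u" if "norm z < 1" for z u
    unfolding \<Phi>_def
  proof (rule summable_sums, rule summable_comparison_test')
    show "summable (\<lambda>k. norm z ^ k * norm u)" using that by (intro summable_mult2 summable_geometric) simp
    show "norm (z ^ k *\<^sub>C p k u) \<le> norm z ^ k * norm u" for k
      by (simp add: norm_power bd mult_left_mono)
  qed
  \<comment> \<open>Applying \<open>W\<close> to the state series shifts its index by one; the input
    supplies the missing term \<open>p 0 u\<close>.\<close>
  have state: "W (z *\<^sub>C fst (\<Phi> z u), u) = \<Phi> z u" if z: "norm z < 1" for z u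
  proof -
    have "bounded_linear (\<lambda>q :: 'x \<times> 'g. W (z *\<^sub>C fst q, 0))"
    proof (rule clinear_bounded_linear[where K = "norm z"])
      show "clinear (\<lambda>q :: 'x \<times> 'g. W (z *\<^sub>C fst q, 0))"
        by (intro clinear_compose[OF W] clinear_Pair clinear_const_zero)
          (simp add: clinear_def scaleC_prod_def scaleC_add_right mult.commute)
      show "norm (W (z *\<^sub>C fst q, 0)) \<le> norm z * norm q" for q :: "'x \<times> 'g"
        using contr[of "(z *\<^sub>C fst q, 0)"]
          mult_left_mono[OF norm_fst_le[of "fst q" "snd q"] norm_ge_zero[of z]] by simp
    qed
    from bounded_linear.sums[OF this \<Phi>[OF z, of u]]
    have "(\<lambda>k. W (z *\<^sub>C fst (z ^ k *\<^sub>C p k u), 0)) sums W (z *\<^sub>C fst (\<Phi> z u), 0)" .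
    moreover have "W (z *\<^sub>C fst (z ^ k *\<^sub>C p k u), 0) = z ^ Suc k *\<^sub>C p (Suc k) u" for k
      using clinear_scaleC[OF W, of "z ^ Suc k" "(fst (p k u), 0)"]
      by (simp add: p_Suc scaleC_prod_def)
    ultimately have "(\<lambda>k. z ^ Suc k *\<^sub>C p (Suc k) u) sums W (z *\<^sub>C fst (\<Phi> z u), 0)" by simp
    from sums_Suc[OF this] \<Phi>[OF z, of u]
    have "\<Phi> z u = W (z *\<^sub>C fst (\<Phi> z u), 0) + W (0, u)" by (simp add: sums_iff p_0)
    also have "\<dots> = W (z *\<^sub>C fst (\<Phi> z u), u)"
      using clinear_add[OF W, of "(z *\<^sub>C fst (\<Phi> z u), 0)" "(0, u)"] by simp
    finally show ?thesis by simp
  qed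
  have sn: "(\<lambda>k. z ^ k *\<^sub>C snd (p k u)) sums snd (\<Phi> z u)" if "norm z < 1" for z u
    using bounded_linear.sums[OF bounded_linear_snd \<Phi>[OF that, of u]] by (simp add: scaleC_prod_def)
  \<comment> \<open>The state on the left dominates |z|^2 times its own square on the right, so only
    output against input remains.\<close>
  have sn_bd: "norm (snd (\<Phi> z u)) \<le> norm u" if z: "norm z < 1" for z u
  proof -
    have "(norm (\<Phi> z u))\<^sup>2 \<le> (norm (z *\<^sub>C fst (\<Phi> z u), u))\<^sup>2"
      using contr[of "(z *\<^sub>C fst (\<Phi> z u), u)"] by (intro power_mono) (simp_all add: state[OF z])
    then have "(norm (fst (\<Phi> z u)))\<^sup>2 + (norm (snd (\<Phi> z u)))\<^sup>2 \<le> (norm z)\<^sup>2 * (norm (fst (\<Phi> z u)))\<^sup>2 + (norm u)\<^sup>2"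
      by (simp add: norm_prod_def power_mult_distrib)
    moreover have "(norm z)\<^sup>2 * (norm (fst (\<Phi> z u)))\<^sup>2 \<le> 1 * (norm (fst (\<Phi> z u)))\<^sup>2"
      using z by (intro mult_right_mono) (auto simp: abs_square_le_1)
    ultimately have "(norm (snd (\<Phi> z u)))\<^sup>2 \<le> (norm u)\<^sup>2" by linarith
    then show ?thesis by (rule power2_le_imp_le) simp
  qed
  have clin: "clinear (\<lambda>u. snd (\<Phi> z u))" if z: "norm z < 1" for z
  proof (rule clinearI)
    show "snd (\<Phi> z (u + v)) = snd (\<Phi> z u) + snd (\<Phi> z v)" for u v
      using sums_add[OF sn[OF z, of u] sn[OF z, of v]] sn[OF z, of "u + v"]
      by (simp add: clinear_add[OF lin] scaleC_add_right sums_iff)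
    show "snd (\<Phi> z (c *\<^sub>C u)) = c *\<^sub>C snd (\<Phi> z u)" for c u
      using bounded_linear.sums[OF bounded_linear_scaleC_right sn[OF z, of u], of c] sn[OF z, of "c *\<^sub>C u"]
      by (simp add: clinear_scaleC[OF lin] mult.commute sums_iff scaleC_prod_def)
  qed
  \<comment> \<open>Outside the disk this value carries no information, and the Schur class ignores
    it.\<close>
  define T where "T z = CBlinfun (\<lambda>u. snd (\<Phi> z u))" for z
  have T: "cblinfun_apply (T z) u = snd (\<Phi> z u)" if z: "norm z < 1" for z u
    unfolding T_def
    by (subst cblinfun_apply_CBlinfun[where K = 1]) (use clin[OF z] sn_bd[OF z] in auto)
  have "T cdifferentiable_on ball 0 1"
  proof (rule power_series_cdifferentiable[where t = "\<lambda>k u. snd (p k u)"])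
    show "clinear (\<lambda>u. snd (p k u))" for k by (rule clinear_snd[OF lin])
    show "norm (snd (p k u)) \<le> norm u" for k u
      using norm_snd_le[of "snd (p k u)" "fst (p k u)"] bd[of k u] by simp
  qed (simp add: sn T)
  moreover have "norm (T z) \<le> 1" if "z \<in> ball 0 1" for z
    by (rule norm_cblinfun_le) (use that sn_bd in \<open>auto simp: T\<close>)
  ultimately have "T \<in> schur_class" by (simp add: schur_class_def)
  moreover have "\<exists>\<xi>. W (z *\<^sub>C \<xi>, u) = (\<xi>, cblinfun_apply (T z) u)" if "norm z < 1" for z u
    using state[OF that] T[OF that] by (metis prod.collapse)
  ultimately show thesis using that by blast
qed

section \<open>From contractive multipliers to Schur functions\<close>

text \<open>Cited by position below. The last two identities say that the squared weights of the
  backward shift and of its defect operator add up to 1, with index 0 left entirely to the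
  defect.\<close>

lemma weight_decseq_bounds:
  assumes "weight_sequence \<beta>" "decseq \<beta>"
  shows "0 < \<beta> j" "\<beta> j \<le> 1" "\<beta> (Suc j) / \<beta> j \<le> 1" "0 \<le> gamma_inv \<beta> j"
    "\<beta> (Suc j) * gamma_inv \<beta> (Suc j) = 1 - \<beta> (Suc j) / \<beta> j" "\<beta> 0 * gamma_inv \<beta> 0 = 1"
proof -
  show pos: "0 < \<beta> j" for j using assms(1) by (simp add: weight_sequence_def)
  show "\<beta> j \<le> 1" using decseqD[OF assms(2), of 0 j] assms(1) by (simp add: weight_sequence_def)
  show le: "\<beta> (Suc j) / \<beta> j \<le> 1" for j using decseqD[OF assms(2), of j "Suc j"] pos[of j] by simp
  show eq: "\<beta> (Suc j) * gamma_inv \<beta> (Suc j) = 1 - \<beta> (Suc j) / \<beta> j" for j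
    using pos[of "Suc j"] by (simp add: gamma_inv_def field_simps)
  show "\<beta> 0 * gamma_inv \<beta> 0 = 1" using assms(1) by (simp add: gamma_inv_def weight_sequence_def)
  show "0 \<le> gamma_inv \<beta> j"
  proof (cases j)
    case 0
    then show ?thesis by (simp add: gamma_inv_def)
  next
    case (Suc i)
    have "0 \<le> \<beta> (Suc i) * gamma_inv \<beta> (Suc i)" unfolding eq using le[of i] by simp
    then show ?thesis using pos[of "Suc i"] Suc by (simp add: zero_le_mult_iff)
  qed
qed

lemma ell2_in_whardy:
  assumes "weight_sequence \<beta>" "decseq \<beta>"
  shows "ell2_nth f \<in> whardy \<beta>"
  unfolding whardy_def mem_Collect_eq
  by (rule summable_comparison_test'[OF ell2_summable[of f]])
    (use weight_decseq_bounds[OF assms] in \<open>auto simp: abs_mult less_imp_le intro: mult_left_le_one_le\<close>)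

text \<open>\<open>N\<close> is multiplication by \<open>S\<close> with the k-th output coefficient
  scaled by \<open>sqrt (\<beta> k)\<close>, which turns the weighted target norm into the
  \<open>ell2\<close> norm. Commutation with multiplication by z becomes a weighted shift
  relation.\<close>

lemma contractive_multiplier_operator:
  fixes S :: "complex \<Rightarrow> 'u::chilbert_space \<Rightarrow>\<^sub>C\<^sub>L 'y::chilbert_space"
  assumes ws: "weight_sequence \<beta>" and dec: "decseq \<beta>" and S: "S \<in> contractive_multipliers \<beta>"
  obtains N :: "'u ell2 \<Rightarrow> 'y ell2" where "clinear N" "\<And>f. norm (N f) \<le> norm f"
    "\<And>f j. ell2_nth (N (ell2_shift f)) (Suc j) = sqrt (\<beta> (Suc j) / \<beta> j) *\<^sub>R ell2_nth (N f) j"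
    "\<And>f. ell2_nth (N (ell2_shift f)) 0 = 0"
    "\<And>(z::complex) u. norm z < 1 \<Longrightarrow>
      (\<lambda>j. (z ^ j / sqrt (\<beta> j)) *\<^sub>C ell2_nth (N (ell2_const u)) j) sums cblinfun_apply (S z) u"
proof -
  note pos = weight_decseq_bounds(1)[OF ws dec]
  have "\<exists>g\<in>whardy \<beta>. (\<forall>z\<in>ball 0 1. ps_eval g z = cblinfun_apply (S z) (ps_eval (ell2_nth f) z)) \<and>
      whardy_norm \<beta> g \<le> norm f" for f
  proof -
    have "ell2_nth f \<in> hardy" using ell2_summable[of f] by (simp add: whardy_def)
    then show ?thesis using S by (auto simp: contractive_multipliers_def whardy_norm_def norm_ell2_def)
  qed
  \<comment> \<open>The products are chosen separately for each \<open>f\<close>; that the choice is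
    linear and respects the shift follows from uniqueness of power series coefficients.\<close>
  then obtain g where g: "\<And>f. g f \<in> whardy \<beta>"
    and gS: "\<And>f z. z \<in> ball 0 1 \<Longrightarrow> ps_eval (g f) z = cblinfun_apply (S z) (ps_eval (ell2_nth f) z)"
    and gn: "\<And>f. whardy_norm \<beta> (g f) \<le> norm f" by metis
  have gs: "(\<lambda>k. z ^ k *\<^sub>C g f k) sums cblinfun_apply (S z) (ps_eval (ell2_nth f) z)" if "norm z < 1" for f z
    using ps_eval_sums[OF ws g[of f], of z] gS[of z f] that by simp
  have pe: "(\<lambda>k. z ^ k *\<^sub>C ell2_nth f k) sums ps_eval (ell2_nth f) z" if "norm z < 1" for f :: "'u ell2" and z
    using ps_eval_sums[OF ws ell2_in_whardy[OF ws dec]] that by simp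
  have g_add: "g (f + f') = (\<lambda>k. g f k + g f' k)" for f f'
  proof (rule power_series_unique[OF gs])
    fix z :: complex assume z: "norm z < 1"
    have "ps_eval (ell2_nth (f + f')) z = ps_eval (ell2_nth f) z + ps_eval (ell2_nth f') z"
      using sums_add[OF pe[OF z, of f] pe[OF z, of f']] pe[OF z, of "f + f'"]
      by (simp add: plus_ell2.rep_eq scaleC_add_right sums_iff)
    then show "(\<lambda>k. z ^ k *\<^sub>C (g f k + g f' k)) sums cblinfun_apply (S z) (ps_eval (ell2_nth (f + f')) z)"
      using sums_add[OF gs[OF z, of f] gs[OF z, of f']]
      by (simp add: scaleC_add_right clinear_add[OF cblinfun_clinear])
  qed
  have g_scale: "g (c *\<^sub>C f) = (\<lambda>k. c *\<^sub>C g f k)" for c f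
  proof (rule power_series_unique[OF gs])
    fix z :: complex assume z: "norm z < 1"
    have "ps_eval (ell2_nth (c *\<^sub>C f)) z = c *\<^sub>C ps_eval (ell2_nth f) z"
      using bounded_linear.sums[OF bounded_linear_scaleC_right pe[OF z, of f], of c] pe[OF z, of "c *\<^sub>C f"]
      by (simp add: scaleC_ell2.rep_eq mult.commute sums_iff)
    then show "(\<lambda>k. z ^ k *\<^sub>C (c *\<^sub>C g f k)) sums cblinfun_apply (S z) (ps_eval (ell2_nth (c *\<^sub>C f)) z)"
      using bounded_linear.sums[OF bounded_linear_scaleC_right gs[OF z, of f], of c]
      by (simp add: mult.commute clinear_scaleC[OF cblinfun_clinear])
  qed
  have g_shift: "g (ell2_shift f) = case_nat 0 (g f)" for f
  proof (rule power_series_unique[OF gs])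
    fix z :: complex assume z: "norm z < 1"
    have mult_z: "(\<lambda>k. z ^ k *\<^sub>C case_nat 0 a k) sums (z *\<^sub>C s)" if "(\<lambda>k. z ^ k *\<^sub>C a k) sums s"
      for a :: "nat \<Rightarrow> 'b::complex_normed_vector" and s
      using sums_Suc[of "\<lambda>k. z ^ k *\<^sub>C case_nat 0 a k" "z *\<^sub>C s"]
        bounded_linear.sums[OF bounded_linear_scaleC_right that, of z] by simp
    have "ps_eval (ell2_nth (ell2_shift f)) z = z *\<^sub>C ps_eval (ell2_nth f) z"
      using mult_z[OF pe[OF z, of f]] pe[OF z, of "ell2_shift f"] by (simp add: ell2_nth_shift sums_iff)
    then show "(\<lambda>k. z ^ k *\<^sub>C case_nat 0 (g f) k) sums
        cblinfun_apply (S z) (ps_eval (ell2_nth (ell2_shift f)) z)"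
      using mult_z[OF gs[OF z, of f]] by (simp add: clinear_scaleC[OF cblinfun_clinear])
  qed
  define N where "N f = Ell2 (\<lambda>k. sqrt (\<beta> k) *\<^sub>R g f k)" for f
  have sq: "(norm (sqrt (\<beta> k) *\<^sub>R g f k))\<^sup>2 = \<beta> k * (norm (g f k))\<^sup>2" for f k
    using pos[of k] by (simp add: power_mult_distrib)
  have N: "ell2_nth (N f) = (\<lambda>k. sqrt (\<beta> k) *\<^sub>R g f k)" for f
    unfolding N_def by (rule ell2_nth_Ell2) (use g[of f] in \<open>simp only: sq whardy_def mem_Collect_eq\<close>)
  have N_eval: "(\<lambda>j. (z ^ j / sqrt (\<beta> j)) *\<^sub>C ell2_nth (N (ell2_const u)) j) sums cblinfun_apply (S z) u"
    if z: "norm z < 1" for z :: complex and u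
  proof -
    have "(\<lambda>k. z ^ k *\<^sub>C ell2_nth (ell2_const u) k) sums (\<Sum>k\<in>{0}. z ^ k *\<^sub>C ell2_nth (ell2_const u) k)"
      by (rule sums_finite) (auto simp: ell2_nth_const)
    then have "ps_eval (ell2_nth (ell2_const u)) z = u"
      using pe[OF z, of "ell2_const u"] by (simp add: ell2_nth_const sums_iff)
    moreover have "(z ^ j / sqrt (\<beta> j)) *\<^sub>C ell2_nth (N (ell2_const u)) j = z ^ j *\<^sub>C g (ell2_const u) j" for j
      using pos[of j] by (simp add: N scaleR_scaleC)
    ultimately show ?thesis using gs[OF z, of "ell2_const u"] by simp
  qed
  show thesis
  proof (rule that)
    show "clinear N"
      by (rule clinearI; rule ell2_eqI)
        (simp_all add: N plus_ell2.rep_eq scaleC_ell2.rep_eq g_add g_scale scaleC_add_right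
          scaleR_scaleC mult.commute)
    show "norm (N f) \<le> norm f" for f
      using gn[of f] by (simp only: norm_ell2_def[of "N f"] N sq whardy_norm_def)
    show "ell2_nth (N (ell2_shift f)) (Suc j) = sqrt (\<beta> (Suc j) / \<beta> j) *\<^sub>R ell2_nth (N f) j" for f j
      using pos[of j] by (simp add: N g_shift real_sqrt_divide)
    show "ell2_nth (N (ell2_shift f)) 0 = 0" for f by (simp add: N g_shift)
  qed (rule N_eval)
qed

lemma contractive_multiplier_imp_schur:
  fixes S :: "complex \<Rightarrow> 'u::chilbert_space \<Rightarrow>\<^sub>C\<^sub>L 'y::chilbert_space"
  assumes ws: "weight_sequence \<beta>" and dec: "decseq \<beta>" and S: "S \<in> contractive_multipliers \<beta>"
  shows "\<exists>T :: complex \<Rightarrow> 'u \<Rightarrow>\<^sub>C\<^sub>L 'y ell2.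
    T \<in> schur_class \<and> (\<forall>z\<in>ball 0 1. S z = Psi \<beta> z o\<^sub>C\<^sub>L T z)"
proof -
  note wt = weight_decseq_bounds[OF ws dec]
  obtain N :: "'u ell2 \<Rightarrow> 'y ell2" where N: "clinear N" and N_le: "\<And>f. norm (N f) \<le> norm f"
    and N_shift: "\<And>f j. ell2_nth (N (ell2_shift f)) (Suc j) = sqrt (\<beta> (Suc j) / \<beta> j) *\<^sub>R ell2_nth (N f) j"
    and N_shift_0: "\<And>f. ell2_nth (N (ell2_shift f)) 0 = 0"
    and N_eval: "\<And>(z::complex) u. norm z < 1 \<Longrightarrow>
      (\<lambda>j. (z ^ j / sqrt (\<beta> j)) *\<^sub>C ell2_nth (N (ell2_const u)) j) sums cblinfun_apply (S z) u"
    by (rule contractive_multiplier_operator[OF assms]) blast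
  obtain Z where Z: "clinear Z" and Z_le: "\<And>x. norm (Z x) \<le> norm x"
    and NZ: "\<And>f x. cinner f (Z x) = cinner (N f) x"
    by (rule douglas[OF clinear_ident N N_le]) blast
  \<comment> \<open>\<open>B\<close> is the adjoint of the weighted shift in the relation
    \<open>N_shift\<close>, and \<open>G\<close> is its diagonal defect operator.\<close>
  define B where "B x = Ell2 (\<lambda>j. sqrt (\<beta> (Suc j) / \<beta> j) *\<^sub>R ell2_nth x (Suc j))" for x :: "'y ell2"
  define G where "G x = Ell2 (\<lambda>j. sqrt (\<beta> j * gamma_inv \<beta> j) *\<^sub>R ell2_nth x j)" for x :: "'y ell2"
  have sum_B: "summable (\<lambda>j. (norm (sqrt (\<beta> (Suc j) / \<beta> j) *\<^sub>R ell2_nth x (Suc j)))\<^sup>2)" for x :: "'y ell2"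
  proof (rule summable_comparison_test')
    show "summable (\<lambda>j. (norm (ell2_nth x (Suc j)))\<^sup>2)"
      using ell2_summable[of x] by (simp add: summable_Suc_iff[of "\<lambda>j. (norm (ell2_nth x j))\<^sup>2"])
    show "norm ((norm (sqrt (\<beta> (Suc j) / \<beta> j) *\<^sub>R ell2_nth x (Suc j)))\<^sup>2) \<le> (norm (ell2_nth x (Suc j)))\<^sup>2" for j
      using mult_right_mono[OF wt(3)[of j], of "(norm (ell2_nth x (Suc j)))\<^sup>2"] wt(1)[of j] wt(1)[of "Suc j"]
      by (simp add: power_mult_distrib)
  qed
  have B: "ell2_nth (B x) = (\<lambda>j. sqrt (\<beta> (Suc j) / \<beta> j) *\<^sub>R ell2_nth x (Suc j))" for x
    unfolding B_def by (rule ell2_nth_Ell2[OF sum_B])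
  have wG: "0 \<le> \<beta> j * gamma_inv \<beta> j" "\<beta> j * gamma_inv \<beta> j \<le> 1" for j
  proof -
    show "0 \<le> \<beta> j * gamma_inv \<beta> j" using wt(1,4)[of j] by simp
    show "\<beta> j * gamma_inv \<beta> j \<le> 1"
      using wt(1)[of "j - 1"] wt(1)[of j] wt(5)[of "j - 1"] wt(6) by (cases j) auto
  qed
  have sum_G: "summable (\<lambda>j. (norm (sqrt (\<beta> j * gamma_inv \<beta> j) *\<^sub>R ell2_nth x j))\<^sup>2)" for x :: "'y ell2"
    by (rule summable_comparison_test'[OF ell2_summable[of x]])
      (use wG in \<open>simp add: power_mult_distrib mult_left_le_one_le\<close>)
  have G: "ell2_nth (G x) = (\<lambda>j. sqrt (\<beta> j * gamma_inv \<beta> j) *\<^sub>R ell2_nth x j)" for x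
    unfolding G_def by (rule ell2_nth_Ell2[OF sum_G])
  have B_lin: "clinear B" and G_lin: "clinear G"
    by (rule clinearI; rule ell2_eqI; simp add: B G plus_ell2.rep_eq scaleC_ell2.rep_eq
        scaleC_add_right scaleR_scaleC mult.commute)+
  \<comment> \<open>Entry j of \<open>B x\<close> and entry j+1 of \<open>G x\<close> both come from
    entry j+1 of \<open>x\<close>, with squared weights adding up to 1; entry 0 of \<open>x\<close>
    survives only in \<open>G x\<close>.\<close>
  have BG: "(norm x)\<^sup>2 = (norm (B x))\<^sup>2 + (norm (G x))\<^sup>2" for x
  proof -
    have "(\<lambda>j. (norm (ell2_nth (G x) (Suc j)))\<^sup>2) sums ((norm (G x))\<^sup>2 - (norm (ell2_nth x 0))\<^sup>2)"
      using norm_ell2_sums[of "G x"]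
      by (subst sums_Suc_iff) (simp add: G wt(6))
    from sums_add[OF norm_ell2_sums[of "B x"] this]
    have "(\<lambda>j. (norm (ell2_nth x (Suc j)))\<^sup>2) sums ((norm (B x))\<^sup>2 + ((norm (G x))\<^sup>2 - (norm (ell2_nth x 0))\<^sup>2))"
    proof (rule sums_cong[THEN iffD1, rotated])
      fix j
      have "(norm (ell2_nth (B x) j))\<^sup>2 = \<beta> (Suc j) / \<beta> j * (norm (ell2_nth x (Suc j)))\<^sup>2"
        using wt(1)[of j] wt(1)[of "Suc j"] by (simp add: B power_mult_distrib)
      moreover have "(norm (ell2_nth (G x) (Suc j)))\<^sup>2 = (1 - \<beta> (Suc j) / \<beta> j) * (norm (ell2_nth x (Suc j)))\<^sup>2"
        using wG(1)[of "Suc j"] by (simp add: G power_mult_distrib wt(5))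
      ultimately show "(norm (ell2_nth (B x) j))\<^sup>2 + (norm (ell2_nth (G x) (Suc j)))\<^sup>2 = (norm (ell2_nth x (Suc j)))\<^sup>2"
        by (simp add: algebra_simps)
    qed
    moreover have "(\<lambda>j. (norm (ell2_nth x (Suc j)))\<^sup>2) sums ((norm x)\<^sup>2 - (norm (ell2_nth x 0))\<^sup>2)"
      using norm_ell2_sums[of x] by (subst sums_Suc_iff) simp
    ultimately show ?thesis using sums_unique2 by fastforce
  qed
  \<comment> \<open>The adjoint of the intertwining of the two forward shifts by
    \<open>N\<close>.\<close>
  have ZB: "Z (B x) = ell2_backshift (Z x)" for x
  proof (rule cinner_ext_right)
    fix f
    have "(\<lambda>j. cinner (ell2_nth (N (ell2_shift f)) (Suc j)) (ell2_nth x (Suc j))) sums cinner (N (ell2_shift f)) x"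
      using cinner_ell2_sums[of "N (ell2_shift f)" x]
      by (subst sums_Suc_iff) (simp add: N_shift_0)
    moreover have "(\<lambda>j. cinner (ell2_nth (N f) j) (ell2_nth (B x) j)) sums cinner (N f) (B x)"
      by (rule cinner_ell2_sums)
    ultimately have "cinner (N f) (B x) = cinner (N (ell2_shift f)) x"
      by (simp add: N_shift B cinner_scaleR_left cinner_scaleR_right sums_iff)
    then show "cinner f (Z (B x)) = cinner f (ell2_backshift (Z x))"
      by (simp add: NZ[symmetric] cinner_ell2_shift)
  qed
  have ZN_inner: "inner (N f) x = inner f (Z x)" for f x using NZ[of f x] by (simp add: inner_eq_Re_cinner)
  have ZN_inner': "inner x (N f) = inner (Z x) f" for f x
    using ZN_inner[of f x] by (simp only: inner_commute[of x] inner_commute[of "Z x"])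
  obtain R :: "'y ell2 \<Rightarrow> 'y ell2 ell2" where R: "clinear R" and R_norm: "\<And>x. (norm (R x))\<^sup>2 = inner (x - N (Z x)) x"
  proof (rule clinear_square_root)
    show "clinear (\<lambda>x. x - N (Z x))"
      using clinear_compose[OF N Z] by (simp add: clinear_def scaleC_diff_right)
    show "inner (x - N (Z x)) y = inner x (y - N (Z y))" for x y
      by (simp add: inner_diff_left inner_diff_right ZN_inner ZN_inner')
    \<comment> \<open>With q = N (Z x), contractivity gives norm(q)^2 at most norm(Z x)^2 = inner q
      x, which absorbs one of the two cross terms in the expansion.\<close>
    show "(norm (x - N (Z x)))\<^sup>2 \<le> inner (x - N (Z x)) x" for x
    proof -
      have "(norm (N (Z x)))\<^sup>2 \<le> (norm (Z x))\<^sup>2" by (intro power_mono N_le) simp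
      then have "(norm (N (Z x)))\<^sup>2 \<le> inner (N (Z x)) x" by (simp add: ZN_inner power2_norm_eq_inner)
      moreover have "(norm (x - q))\<^sup>2 = (norm x)\<^sup>2 - 2 * inner q x + (norm q)\<^sup>2" for q
        by (simp add: power2_norm_eq_inner inner_diff_left inner_diff_right inner_commute)
      ultimately show ?thesis by (simp add: inner_diff_left power2_norm_eq_inner[of x])
    qed
  qed blast
  have R_norm': "(norm (R x))\<^sup>2 = (norm x)\<^sup>2 - (norm (Z x))\<^sup>2" for x
    by (simp add: R_norm inner_diff_left ZN_inner power2_norm_eq_inner[of x] power2_norm_eq_inner[of "Z x"])
  have nth_lin: "clinear (\<lambda>x. ell2_nth x 0)"
    by (simp add: clinear_def plus_ell2.rep_eq scaleC_ell2.rep_eq)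
  \<comment> \<open>The lurking isometry sends \<open>E x\<close> to \<open>F x\<close>. Equality of
    norms combines \<open>BG\<close>, \<open>ZB\<close> and the splitting of norm(Z x)^2 into entry
    0 and the backward shift.\<close>
  define E where "E x = (R (B x), G x)" for x
  define F where "F x = (R x, ell2_nth (Z x) 0)" for x
  have E_lin: "clinear E" unfolding E_def by (intro clinear_Pair clinear_compose[OF R] B_lin G_lin)
  have F_lin: "clinear F" unfolding F_def by (intro clinear_Pair R clinear_compose[OF nth_lin] Z)
  have "norm (F x) = norm (E x)" for x
  proof -
    have "(norm (F x))\<^sup>2 = (norm (E x))\<^sup>2"
      using BG[of x] norm_ell2_backshift[of "Z x"]
      by (simp add: E_def F_def norm_prod_def R_norm' ZB algebra_simps)
    then show ?thesis by simp
  qed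
  then have le: "norm (F x) \<le> norm (E x)" for x by simp
  \<comment> \<open>\<open>W\<close> acts as the adjoint of \<open>E x\<close> ->
    \<open>F x\<close>, so it maps state and input to next state and output.\<close>
  obtain W where W: "clinear W" and W_le: "\<And>v. norm (W v) \<le> norm v"
    and EW: "\<And>x v. cinner (E x) (W v) = cinner (F x) v"
    by (rule douglas[OF E_lin F_lin le]) blast
  obtain T :: "complex \<Rightarrow> 'u \<Rightarrow>\<^sub>C\<^sub>L 'y ell2" where T: "T \<in> schur_class"
    and TW: "\<And>z u. norm z < 1 \<Longrightarrow> \<exists>\<xi>. W (z *\<^sub>C \<xi>, u) = (\<xi>, cblinfun_apply (T z) u)"
    by (rule contractive_colligation_transfer_function[OF W W_le]) blast
  have "S z = Psi \<beta> z o\<^sub>C\<^sub>L T z" if z: "z \<in> ball 0 1" for z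
  proof (rule cblinfun_apply_inject[THEN iffD1], rule ext, rule cinner_ext_right)
    fix u :: 'u and y :: 'y
    have nz: "norm z < 1" using z by simp
    obtain \<xi> where \<xi>: "W (z *\<^sub>C \<xi>, u) = (\<xi>, cblinfun_apply (T z) u)" using TW[OF nz] by blast
    \<comment> \<open>In the rescaled coordinates this is the kernel vector at \<open>z\<close> in
      direction \<open>y\<close>, an eigenvector of \<open>B\<close> with eigenvalue
      \<open>cnj z\<close>.\<close>
    define x where "x = Ell2 (\<lambda>j. (cnj z ^ j / sqrt (\<beta> j)) *\<^sub>C y)"
    have x: "ell2_nth x = (\<lambda>j. (cnj z ^ j / sqrt (\<beta> j)) *\<^sub>C y)"
      unfolding x_def
    proof (rule ell2_nth_Ell2)
      have "(norm ((cnj z ^ j / sqrt (\<beta> j)) *\<^sub>C y))\<^sup>2 = norm z ^ (2 * j) / \<beta> j * (norm y)\<^sup>2" for j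
        using wt(1)[of j]
        by (simp add: norm_divide norm_power power_mult_distrib power_divide mult.commute[of 2] power_mult)
      then show "summable (\<lambda>j. (norm ((cnj z ^ j / sqrt (\<beta> j)) *\<^sub>C y))\<^sup>2)"
        using summable_mult2[OF summable_power_div_weight[OF ws nz], of "(norm y)\<^sup>2"] by simp
    qed
    have Bx: "B x = cnj z *\<^sub>C x"
    proof (rule ell2_eqI)
      fix j
      show "ell2_nth (B x) j = ell2_nth (cnj z *\<^sub>C x) j"
        using wt(1)[of j] wt(1)[of "Suc j"]
        by (simp add: B x scaleC_ell2.rep_eq scaleR_scaleC real_sqrt_divide)
    qed
    \<comment> \<open>Since \<open>R (B x)\<close> is \<open>cnj z *\<^sub>C R x\<close>, the state
      contributes the same term, cnj z times \<open>cinner (R x) \<xi>\<close>, on both sides and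
      cancels.\<close>
    have "cinner (G x) (cblinfun_apply (T z) u) = cinner (ell2_nth (Z x) 0) u"
      using EW[of x "(z *\<^sub>C \<xi>, u)"]
      by (simp add: \<xi> E_def F_def cinner_prod_def Bx clinear_scaleC[OF R] cinner_scaleC_left cinner_scaleC_right)
    \<comment> \<open>The factor \<open>sqrt (\<beta> j)\<close> in \<open>G\<close> cancels the one
      in \<open>x\<close>, leaving exactly the coefficients of \<open>Psi\<close>.\<close>
    moreover have "cinner (G x) g = cinner y (cblinfun_apply (Psi \<beta> z) g)" for g
    proof -
      have "cinner (ell2_nth (G x) j) (ell2_nth g j) =
          cinner y (z ^ j *\<^sub>C complex_of_real (sqrt (gamma_inv \<beta> j)) *\<^sub>C ell2_nth g j)" for j
        using wt(1)[of j]
        by (simp add: G x scaleR_scaleC cinner_scaleC_left cinner_scaleC_right real_sqrt_mult)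
      with cinner_ell2_sums[of "G x" g]
        bounded_linear.sums[OF bounded_linear_cinner_right Psi_apply[OF ws dec z, of g], of y]
      show ?thesis by (simp add: sums_iff)
    qed
    moreover have "cinner (ell2_nth (Z x) 0) u = cinner y (cblinfun_apply (S z) u)"
    proof -
      \<comment> \<open>Reading off entry 0 is pairing with a constant sequence, after which
        \<open>Z\<close> can be moved across as \<open>N\<close>.\<close>
      have "cinner (ell2_nth (Z x) 0) u = cinner x (N (ell2_const u))"
        unfolding cinner_ell2_const[symmetric] by (metis NZ cinner_commute)
      moreover have "cinner (ell2_nth x j) (ell2_nth (N (ell2_const u)) j) =
          cinner y ((z ^ j / sqrt (\<beta> j)) *\<^sub>C ell2_nth (N (ell2_const u)) j)" for j
        by (simp add: x cinner_scaleC_left cinner_scaleC_right)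
      ultimately show ?thesis
        using cinner_ell2_sums[of x "N (ell2_const u)"]
          bounded_linear.sums[OF bounded_linear_cinner_right N_eval[OF nz, of u], of y]
        by (simp add: sums_iff)
    qed
    ultimately show "cinner y (cblinfun_apply (S z) u) = cinner y (cblinfun_apply (Psi \<beta> z o\<^sub>C\<^sub>L T z) u)"
      by (simp add: cblinfun_compose.rep_eq)
  qed
  with T show ?thesis by blast
qed

section \<open>Taylor coefficients of Schur functions\<close>

text \<open>Let r tend to 1 from the left; this removes the radius from Cauchy estimates on circles
  inside the disk.\<close>

lemma le_if_scaled_powers_le:
  fixes a b :: real
  assumes "\<And>r. 0 < r \<Longrightarrow> r < 1 \<Longrightarrow> r ^ n * a \<le> b"
  shows "a \<le> b"
proof (rule tendsto_upperbound)
  have "((\<lambda>r::real. r ^ n * a) \<longlongrightarrow> 1 ^ n * a) (at_left 1)" by (intro tendsto_intros)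
  then show "((\<lambda>r::real. r ^ n * a) \<longlongrightarrow> a) (at_left 1)" by simp
  have "\<forall>\<^sub>F r in at_left (1::real). r \<in> {0<..<1}" by (rule eventually_at_left_real) simp
  then show "\<forall>\<^sub>F r in at_left (1::real). r ^ n * a \<le> b"
    by eventually_elim (use assms in auto)
qed simp

text \<open>Each scalar function is expanded separately. Its k-th coefficient is antilinear in
  \<open>v\<close> and bounded by C times the norm of \<open>v\<close>, hence represented by a
  vector.\<close>

lemma weakly_holomorphic_power_series:
  fixes F :: "complex \<Rightarrow> 'g::chilbert_space"
  assumes hol: "\<And>v. (\<lambda>z. cinner (F z) v) holomorphic_on ball 0 1"
    and bd: "\<And>z. norm z < 1 \<Longrightarrow> norm (F z) \<le> C"
  obtains c where "\<And>k. norm (c k) \<le> C" "\<And>z. norm z < 1 \<Longrightarrow> (\<lambda>k. z ^ k *\<^sub>C c k) sums F z"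
proof -
  have C: "0 \<le> C" using order_trans[OF norm_ge_zero bd[of 0]] by simp
  define a where "a k v = (deriv ^^ k) (\<lambda>z. cinner (F z) v) 0 / fact k" for k v
  have a_sums: "(\<lambda>k. a k v * z ^ k) sums cinner (F z) v" if "norm z < 1" for z v
    using holomorphic_power_series[OF hol[of v], of z] that by (simp add: a_def)
  have a_add: "a k (v + w) = a k v + a k w" for k v w
    using higher_deriv_add[OF hol[of v] hol[of w] open_ball, of 0 k]
    by (simp add: a_def cinner_add_right add_divide_distrib)
  have a_scale: "a k (c *\<^sub>C v) = cnj c * a k v" for k c v
    using higher_deriv_cmult[OF hol[of v] _ open_ball, of 0 k "cnj c"]
    by (simp add: a_def cinner_scaleC_right)
  have a_bd: "norm (a k v) \<le> C * norm v" for k v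
  proof (rule le_if_scaled_powers_le)
    fix r :: real assume r: "0 < r" "r < 1"
    have "norm ((deriv ^^ k) (\<lambda>z. cinner (F z) v) 0) \<le> fact k * (C * norm v) / r ^ k"
    proof (rule Cauchy_inequality)
      show "(\<lambda>z. cinner (F z) v) holomorphic_on ball 0 r"
        by (rule holomorphic_on_subset[OF hol]) (use r in auto)
      show "continuous_on (cball 0 r) (\<lambda>z. cinner (F z) v)"
        by (rule continuous_on_subset[OF holomorphic_on_imp_continuous_on[OF hol]]) (use r in auto)
      show "norm (cinner (F x) v) \<le> C * norm v" if "norm (0 - x) = r" for x
        using norm_cinner_le[of "F x" v] mult_right_mono[OF bd[of x] norm_ge_zero[of v]] that r by simp
    qed (use r in simp)
    then show "r ^ k * norm (a k v) \<le> C * norm v"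
      using r by (simp add: a_def norm_divide field_simps)
  qed
  \<comment> \<open>Riesz representation along the identity gives real parts only; replacing
    \<open>v\<close> by \<open>\<i> *\<^sub>C v\<close> recovers the complex coefficient.\<close>
  have "\<exists>w. norm w \<le> C \<and> (\<forall>v. inner v w = Re (a k v))" for k
  proof -
    have "linear (\<lambda>v. Re (a k v))"
      by (rule linearI) (simp_all add: a_add scaleR_scaleC a_scale)
    moreover have "\<bar>Re (a k v)\<bar> \<le> C * norm v" for v
      using abs_Re_le_cmod[of "a k v"] a_bd[of k v] by linarith
    ultimately show ?thesis
      using riesz_along[of "\<lambda>v::'g. v" "\<lambda>v. Re (a k v)" C] C linear_id[unfolded id_def] by blast
  qed
  then obtain c where c: "\<And>k. norm (c k) \<le> C" "\<And>k v. inner v (c k) = Re (a k v)" by metis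
  have c_a: "cinner (c k) v = a k v" for k v
  proof -
    have "Re (cinner (c k) v) = Re (a k v)" for v
      using c(2)[of v k] by (simp add: inner_commute flip: inner_eq_Re_cinner)
    from this[of v] this[of "\<i> *\<^sub>C v"] show ?thesis
      by (simp add: complex_eq_iff a_scale cinner_scaleC_right)
  qed
  have "(\<lambda>k. z ^ k *\<^sub>C c k) sums F z" if z: "norm z < 1" for z
  proof -
    have "summable (\<lambda>k. z ^ k *\<^sub>C c k)"
    proof (rule summable_comparison_test')
      show "summable (\<lambda>k. norm z ^ k * C)" using z by (intro summable_mult2 summable_geometric) simp
      show "norm (z ^ k *\<^sub>C c k) \<le> norm z ^ k * C" for k
        by (simp add: norm_power c(1) mult_left_mono)
    qed
    then obtain s where s: "(\<lambda>k. z ^ k *\<^sub>C c k) sums s" by (auto simp: summable_def)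
    \<comment> \<open>Boundedness of the coefficients gave norm convergence; the limit is identified
      weakly.\<close>
    have "s = F z"
    proof (rule cinner_ext)
      show "cinner s v = cinner (F z) v" for v
        using bounded_linear.sums[OF bounded_linear_cinner_left s, of v] a_sums[OF z, of v]
        by (simp add: cinner_scaleC_left c_a mult.commute sums_iff)
    qed
    with s show ?thesis by simp
  qed
  with c(1) that show thesis by blast
qed

text \<open>Operator-norm differentiability makes every matrix entry holomorphic, so each orbit u ->
  T(z)u has a vector expansion. Uniqueness of coefficients makes them linear in u.\<close>

lemma schur_class_power_series:
  fixes T :: "complex \<Rightarrow> 'u::chilbert_space \<Rightarrow>\<^sub>C\<^sub>L 'g::chilbert_space"
  assumes T: "T \<in> schur_class"
  obtains t where "\<And>k. clinear (t k)" "\<And>k u. norm (t k u) \<le> norm u"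
    "\<And>z u. norm z < 1 \<Longrightarrow> (\<lambda>k. z ^ k *\<^sub>C t k u) sums cblinfun_apply (T z) u"
proof -
  have diff: "T cdifferentiable_on ball 0 1" and bd1: "\<And>z. norm z < 1 \<Longrightarrow> norm (T z) \<le> 1"
    using T by (auto simp: schur_class_def)
  have bd: "norm (cblinfun_apply (T z) u) \<le> norm u" if "norm z < 1" for z u
    using norm_cblinfun_apply_le[of "T z" u] mult_right_mono[OF bd1[OF that] norm_ge_zero[of u]] by simp
  have hol: "(\<lambda>z. cinner (cblinfun_apply (T z) u) v) holomorphic_on ball 0 1" for u v
    unfolding holomorphic_on_def
  proof
    fix z :: complex assume "z \<in> ball 0 1"
    then obtain D where D: "(T has_derivative (\<lambda>h. h *\<^sub>C D)) (at z within ball 0 1)"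
      using diff unfolding cdifferentiable_on_def by blast
    have "bounded_linear (\<lambda>A. cinner (cblinfun_apply A u) v)"
    proof (rule bounded_linear_intro[where K = "norm u * norm v"])
      show "norm (cinner (cblinfun_apply A u) v) \<le> norm A * (norm u * norm v)" for A :: "'u \<Rightarrow>\<^sub>C\<^sub>L 'g"
        using norm_cinner_le[of "cblinfun_apply A u" v]
          mult_right_mono[OF norm_cblinfun_apply_le[of A u] norm_ge_zero[of v]] by (simp add: mult.assoc)
    qed (simp_all add: plus_cblinfun.rep_eq cinner_add_left scaleR_cblinfun_def scaleC_cblinfun.rep_eq
        cinner_scaleC_left scaleR_conv_of_real)
    from bounded_linear.has_derivative[OF this D]
    have "((\<lambda>z. cinner (cblinfun_apply (T z) u) v) has_derivative
        (\<lambda>h. cinner (cblinfun_apply D u) v * h)) (at z within ball 0 1)"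
      by (simp add: scaleC_cblinfun.rep_eq cinner_scaleC_left mult.commute)
    then show "(\<lambda>z. cinner (cblinfun_apply (T z) u) v) field_differentiable at z within ball 0 1"
      unfolding field_differentiable_def has_field_derivative_def by blast
  qed
  have "\<exists>c. (\<forall>k. norm (c k) \<le> norm u) \<and> (\<forall>z. norm z < 1 \<longrightarrow> (\<lambda>k. z ^ k *\<^sub>C c k) sums cblinfun_apply (T z) u)" for u
    by (rule weakly_holomorphic_power_series[of "\<lambda>z. cblinfun_apply (T z) u" "norm u"])
      (use hol bd in auto)
  then obtain c where c_bd: "\<And>u k. norm (c u k) \<le> norm u"
    and c: "\<And>u z. norm z < 1 \<Longrightarrow> (\<lambda>k. z ^ k *\<^sub>C c u k) sums cblinfun_apply (T z) u" by metis
  have "c (u + v) = (\<lambda>k. c u k + c v k)" for u v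
    by (rule power_series_unique[OF c]) (use sums_add[OF c c] in \<open>simp_all add: scaleC_add_right clinear_add[OF cblinfun_clinear]\<close>)
  moreover have "c (a *\<^sub>C u) = (\<lambda>k. a *\<^sub>C c u k)" for a u
  proof (rule power_series_unique[OF c])
    show "(\<lambda>k. z ^ k *\<^sub>C a *\<^sub>C c u k) sums cblinfun_apply (T z) (a *\<^sub>C u)" if "norm z < 1" for z
      using bounded_linear.sums[OF bounded_linear_scaleC_right c[OF that, of u], of a]
      by (simp add: mult.commute clinear_scaleC[OF cblinfun_clinear])
  qed
  ultimately have "clinear (\<lambda>u. c u k)" for k by (simp add: clinear_def)
  with c_bd c show thesis using that[of "\<lambda>k u. c u k"] by blast
qed

section \<open>Products of power series\<close>

text \<open>Only the operator factor needs an absolutely summable majorant; the vector series may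
  converge conditionally. The partial sums are handled by dominated convergence.\<close>

lemma operator_Cauchy_product:
  fixes L :: "nat \<Rightarrow> 'a::chilbert_space \<Rightarrow> 'b::chilbert_space"
  assumes L: "\<And>j. clinear (L j)" and L_bd: "\<And>j x. norm (L j x) \<le> M j * norm x" and M0: "\<And>j. 0 \<le> M j"
    and M: "summable (\<lambda>j. norm z ^ j * M j)" and f: "(\<lambda>m. z ^ m *\<^sub>C f m) sums F"
  shows "(\<lambda>k. z ^ k *\<^sub>C (\<Sum>i\<le>k. L i (f (k - i)))) sums (\<Sum>i. z ^ i *\<^sub>C L i F)"
proof -
  define P where "P n = (\<Sum>m<n. z ^ m *\<^sub>C f m)" for n
  have P: "P \<longlonglongrightarrow> F" using f by (simp add: P_def[abs_def] sums_def)
  then obtain b where b: "\<And>n. norm (P n) \<le> b"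
    using convergent_imp_Bseq[of P] by (auto simp: convergent_def Bseq_def)
  \<comment> \<open>Chosen so that summing \<open>z ^ i *\<^sub>C L i (Q n i)\<close> over all i
    yields the n-th partial sum of the product series, while \<open>Q n i\<close> tends to
    \<open>F\<close> for fixed i.\<close>
  define Q where "Q n i = (if i < n then P (n - i) else 0)" for n i
  have b0: "0 \<le> b" using b[of 0] norm_ge_zero order_trans by blast
  have Q: "(\<lambda>n. Q n i) \<longlonglongrightarrow> F" for i
  proof (rule Lim_transform_eventually)
    show "(\<lambda>n. P (n - i)) \<longlonglongrightarrow> F" by (rule LIMSEQ_offset[where k = i]) (simp add: P)
    show "\<forall>\<^sub>F n in sequentially. P (n - i) = Q n i"
      using eventually_gt_at_top[of i] by eventually_elim (simp add: Q_def)
  qed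
  have Q_bd: "norm (Q n i - F) \<le> b + norm F" for n i
    using norm_triangle_ineq4[of "Q n i" F] b[of "n - i"] b0 by (simp add: Q_def split: if_splits)
  define e where "e i n = norm z ^ i * M i * norm (Q n i - F)" for i n
  have e_bd: "norm (e i n) \<le> norm z ^ i * M i * (b + norm F)" for i n
    using mult_left_mono[OF Q_bd[of n i], of "norm z ^ i * M i"] by (simp add: e_def abs_mult M0)
  have sM: "summable (\<lambda>i. norm z ^ i * M i * (b + norm F))" by (rule summable_mult2[OF M])
  have "((\<lambda>n. \<Sum>i. e i n) \<longlongrightarrow> (\<Sum>i. 0)) sequentially"
  proof (rule conjunct2[OF conjunct2[OF tannerys_theorem]])
    have "((\<lambda>n. norm z ^ i * M i * norm (Q n i - F)) \<longlongrightarrow> norm z ^ i * M i * norm (F - F)) sequentially" for i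
      by (intro tendsto_intros Q)
    then show "((\<lambda>n. e i n) \<longlongrightarrow> 0) sequentially" for i by (simp add: e_def)
    show "\<forall>\<^sub>F (i, n) in at_top \<times>\<^sub>F sequentially. norm (e i n) \<le> norm z ^ i * M i * (b + norm F)"
      by (rule always_eventually) (use e_bd in auto)
  qed (use sM in simp_all)
  then have e_lim: "(\<lambda>n. \<Sum>i. e i n) \<longlonglongrightarrow> 0" by simp
  have term_bd: "norm (z ^ i *\<^sub>C L i x) \<le> norm z ^ i * M i * norm x" for i x
    using mult_left_mono[OF L_bd[of i x], of "norm z ^ i"] by (simp add: norm_power mult.assoc)
  have sL: "summable (\<lambda>i. z ^ i *\<^sub>C L i F)"
    by (rule summable_comparison_test'[OF summable_mult2[OF M, of "norm F"]]) (use term_bd in auto)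
  have sQ: "summable (\<lambda>i. z ^ i *\<^sub>C L i (Q n i))" for n
    by (rule summable_finite[of "{..<n}"]) (auto simp: Q_def clinear_zero[OF L])
  have "(\<lambda>n. (\<Sum>i. z ^ i *\<^sub>C L i (Q n i)) - (\<Sum>i. z ^ i *\<^sub>C L i F)) \<longlonglongrightarrow> 0"
  proof (rule Lim_null_comparison[OF always_eventually e_lim], rule allI)
    fix n
    have d: "z ^ i *\<^sub>C L i (Q n i) - z ^ i *\<^sub>C L i F = z ^ i *\<^sub>C L i (Q n i - F)" for i
      by (simp add: clinear_diff[OF L] scaleC_diff_right)
    have se: "summable (\<lambda>i. e i n)"
      by (rule summable_comparison_test'[OF sM]) (use e_bd in auto)
    have sn: "summable (\<lambda>i. norm (z ^ i *\<^sub>C L i (Q n i - F)))"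
      by (rule summable_comparison_test'[OF se]) (use term_bd in \<open>auto simp: e_def\<close>)
    have "norm ((\<Sum>i. z ^ i *\<^sub>C L i (Q n i)) - (\<Sum>i. z ^ i *\<^sub>C L i F)) = norm (\<Sum>i. z ^ i *\<^sub>C L i (Q n i - F))"
      by (simp only: suminf_diff[OF sQ sL] d)
    also have "\<dots> \<le> (\<Sum>i. norm (z ^ i *\<^sub>C L i (Q n i - F)))" by (rule summable_norm[OF sn])
    also have "\<dots> \<le> (\<Sum>i. e i n)" by (rule suminf_le[OF _ sn se]) (use term_bd in \<open>auto simp: e_def\<close>)
    finally show "norm ((\<Sum>i. z ^ i *\<^sub>C L i (Q n i)) - (\<Sum>i. z ^ i *\<^sub>C L i F)) \<le> (\<Sum>i. e i n)" .
  qed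
  then have "(\<lambda>n. \<Sum>i. z ^ i *\<^sub>C L i (Q n i)) \<longlonglongrightarrow> (\<Sum>i. z ^ i *\<^sub>C L i F)" by (rule LIM_zero_cancel)
  moreover have "(\<Sum>i. z ^ i *\<^sub>C L i (Q n i)) =
      (\<Sum>k<n. z ^ k *\<^sub>C (\<Sum>i\<le>k. L i (f (k - i))))" for n
  proof -
    have "(\<Sum>i. z ^ i *\<^sub>C L i (Q n i)) = (\<Sum>i<n. z ^ i *\<^sub>C L i (P (n - i)))"
      by (subst suminf_finite[of "{..<n}"]) (auto simp: Q_def clinear_zero[OF L])
    also have "\<dots> = (\<Sum>i<n. \<Sum>m<n - i. z ^ (i + m) *\<^sub>C L i (f m))"
      by (simp add: P_def linear_sum[OF clinear_imp_linear[OF L]] clinear_scaleC[OF L]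
          linear_sum[OF bounded_linear.linear[OF bounded_linear_scaleC_right]] power_add)
    also have "\<dots> = (\<Sum>(i, m)\<in>(SIGMA i:{..<n}. {..<n - i}). z ^ (i + m) *\<^sub>C L i (f m))"
      by (rule sum.Sigma) auto
    also have "(SIGMA i:{..<n}. {..<n - i}) = {(i, m). i + m < n}" by auto
    also have "(\<Sum>(i, m)\<in>{(i, m). i + m < n}. z ^ (i + m) *\<^sub>C L i (f m)) =
        (\<Sum>k<n. \<Sum>i\<le>k. z ^ (i + (k - i)) *\<^sub>C L i (f (k - i)))"
      by (rule sum.triangle_reindex)
    also have "\<dots> = (\<Sum>k<n. z ^ k *\<^sub>C (\<Sum>i\<le>k. L i (f (k - i))))"
      by (simp add: linear_sum[OF bounded_linear.linear[OF bounded_linear_scaleC_right]])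
    finally show ?thesis .
  qed
  ultimately show ?thesis by (simp add: sums_def)
qed

section \<open>From Schur functions to contractive multipliers\<close>

lemma roots_of_unity_orthogonal:
  assumes "k < n" "l < n"
  defines "\<omega> \<equiv> cis (2 * pi / real n)"
  shows "(\<Sum>j<n. (\<omega> ^ j) ^ k * cnj ((\<omega> ^ j) ^ l)) = (if k = l then of_nat n else 0)"
proof -
  have pw: "\<omega> ^ m = cis (2 * pi * real m / real n)" for m
    by (simp add: \<omega>_def Complex.DeMoivre mult.commute)
  \<comment> \<open>The root of unity with exponent k - l, written with \<open>cnj\<close> since
    exponents are natural; the sum is geometric with this ratio.\<close>
  define q where "q = \<omega> ^ k * cnj (\<omega> ^ l)"
  have unit: "\<omega> ^ m * cnj (\<omega> ^ m) = 1" for m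
    by (simp add: \<omega>_def cis_cnj cis_mult flip: power_mult_distrib)
  have "(\<omega> ^ j) ^ k * cnj ((\<omega> ^ j) ^ l) = q ^ j" for j
    by (simp add: q_def power_mult_distrib power_mult[symmetric] mult.commute)
  then have S: "(\<Sum>j<n. (\<omega> ^ j) ^ k * cnj ((\<omega> ^ j) ^ l)) = (\<Sum>j<n. q ^ j)" by simp
  show ?thesis
  proof (cases "k = l")
    case True
    then have "q = 1" by (simp only: q_def unit)
    with S True show ?thesis by simp
  next
    case False
    have "\<omega> ^ n = 1" using assms(1) by (simp add: pw)
    then have "q ^ n = 1"
      by (simp add: q_def power_mult_distrib power_mult[symmetric] mult.commute[of _ n] flip: complex_cnj_power)
        (simp add: power_mult)
    moreover have "q \<noteq> 1"
    proof
      assume "q = 1"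
      then have "\<omega> ^ k * (cnj (\<omega> ^ l) * \<omega> ^ l) = \<omega> ^ l" by (simp add: q_def mult.assoc[symmetric])
      then have "\<omega> ^ k = \<omega> ^ l" using unit[of l] by (simp only: mult.commute[of "cnj _"] mult_1_right)
      moreover have "inj_on (\<lambda>k. cis (2 * pi * real k / real n)) {..<n}"
        using Complex.bij_betw_roots_unity[of n] assms(1) by (simp add: bij_betw_def)
      ultimately show False using False assms(1,2) by (auto simp: pw inj_on_def)
    qed
    ultimately show ?thesis using False unfolding S by (simp add: geometric_sum)
  qed
qed

lemma clinear_sum: "clinear f \<Longrightarrow> f (\<Sum>i\<in>A. g i) = (\<Sum>i\<in>A. f (g i))"
  by (rule linear_sum[OF clinear_imp_linear])

lemma cinner_sum_left: "cinner (\<Sum>i\<in>A. g i) y = (\<Sum>i\<in>A. cinner (g i) y)"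
  by (rule linear_sum[OF bounded_linear.linear[OF bounded_linear_cinner_left]])

lemma cinner_sum_right: "cinner x (\<Sum>i\<in>A. g i) = (\<Sum>i\<in>A. cinner x (g i))"
  by (rule linear_sum[OF bounded_linear.linear[OF bounded_linear_cinner_right]])

text \<open>Expanding the squares, orthogonality leaves only the diagonal. It serves as a finite
  replacement for integration over a circle.\<close>

lemma discrete_Parseval:
  fixes a :: "nat \<Rightarrow> 'a::complex_inner"
  defines "\<omega> \<equiv> \<lambda>n. cis (2 * pi / real n)"
  shows "(\<Sum>j<n. (norm (\<Sum>k<n. (\<omega> n ^ j) ^ k *\<^sub>C a k))\<^sup>2) = real n * (\<Sum>k<n. (norm (a k))\<^sup>2)"
proof -
  have "complex_of_real (\<Sum>j<n. (norm (\<Sum>k<n. (\<omega> n ^ j) ^ k *\<^sub>C a k))\<^sup>2) =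
      (\<Sum>j<n. \<Sum>k<n. \<Sum>l<n. (\<omega> n ^ j) ^ k * cnj ((\<omega> n ^ j) ^ l) * cinner (a k) (a l))"
    unfolding of_real_sum cinner_self[symmetric] cinner_sum_left cinner_scaleC_left
    by (simp only: cinner_sum_right cinner_scaleC_right sum_distrib_left mult.assoc)
  also have "\<dots> = (\<Sum>k<n. \<Sum>l<n. \<Sum>j<n. (\<omega> n ^ j) ^ k * cnj ((\<omega> n ^ j) ^ l) * cinner (a k) (a l))"
    by (subst sum.swap, rule sum.cong[OF refl], rule sum.swap)
  also have "\<dots> = (\<Sum>k<n. \<Sum>l<n. (if k = l then of_nat n else 0) * cinner (a k) (a l))"
    by (intro sum.cong refl)
      (simp only: sum_distrib_right[symmetric] \<omega>_def roots_of_unity_orthogonal lessThan_iff)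
  also have "\<dots> = (\<Sum>k<n. \<Sum>l<n. if k = l then of_nat n * cinner (a k) (a l) else 0)"
    by (intro sum.cong refl) simp
  also have "\<dots> = (\<Sum>k<n. of_nat n * cinner (a k) (a k))" by (simp add: sum.delta)
  also have "\<dots> = complex_of_real (real n * (\<Sum>k<n. (norm (a k))\<^sup>2))"
    by (simp add: cinner_self sum_distrib_left)
  finally show ?thesis by (simp only: of_real_eq_iff)
qed

text \<open>The inner sums are Taylor coefficients of T f. Parseval on a circle of radius r < 1
  compares truncated series; the truncation degree goes to infinity first, then r tends to
  1.\<close>

lemma lower_triangular_Toeplitz_contraction:
  fixes t :: "nat \<Rightarrow> 'u::chilbert_space \<Rightarrow> 'g::chilbert_space"
  assumes lin: "\<And>k. clinear (t k)" and t_bd: "\<And>k u. norm (t k u) \<le> norm u"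
    and T: "\<And>z u. norm z < 1 \<Longrightarrow> (\<lambda>k. z ^ k *\<^sub>C t k u) sums T z u"
    and T_bd: "\<And>z u. norm z < 1 \<Longrightarrow> norm (T z u) \<le> norm u"
  shows "(\<Sum>k<K. (norm (\<Sum>i\<le>k. t i (f (k - i))))\<^sup>2) \<le> (\<Sum>k<K. (norm (f k))\<^sup>2)"
proof -
  define h where "h k = (\<Sum>i\<le>k. t i (f (k - i)))" for k
  define A where "A = (\<Sum>k<K. (norm (f k))\<^sup>2)"
  \<comment> \<open>The Taylor polynomial is \<open>T\<close> minus a tail that the contractive
    coefficients bound by a geometric series.\<close>
  have trunc: "norm (\<Sum>i<n. z ^ i *\<^sub>C t i x) \<le> (1 + norm z ^ n / (1 - norm z)) * norm x"
    if z: "norm z < 1" for n x z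
  proof -
    have sg: "summable (\<lambda>i. norm z ^ (i + n) * norm x)"
      using z by (intro summable_mult2 summable_ignore_initial_segment summable_geometric) simp
    have le: "norm (z ^ (i + n) *\<^sub>C t (i + n) x) \<le> norm z ^ (i + n) * norm x" for i
      by (simp add: norm_power t_bd mult_left_mono)
    have sn: "summable (\<lambda>i. norm (z ^ (i + n) *\<^sub>C t (i + n) x))"
      by (rule summable_comparison_test'[OF sg]) (use le in auto)
    have "(\<Sum>i<n. z ^ i *\<^sub>C t i x) = T z x - (\<Sum>i. z ^ (i + n) *\<^sub>C t (i + n) x)"
      using suminf_split_initial_segment[OF sums_summable[OF T[OF z, of x]], of n] T[OF z, of x]
      by (auto simp: sums_iff eq_diff_eq add.commute)
    also have "norm \<dots> \<le> norm (T z x) + norm (\<Sum>i. z ^ (i + n) *\<^sub>C t (i + n) x)"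
      by (rule norm_triangle_ineq4)
    also have "norm (\<Sum>i. z ^ (i + n) *\<^sub>C t (i + n) x) \<le> (\<Sum>i. norm z ^ (i + n) * norm x)"
      by (rule order_trans[OF summable_norm[OF sn] suminf_le[OF le sn sg]])
    also have "\<dots> = norm z ^ n / (1 - norm z) * norm x"
      using z by (simp add: power_add suminf_mult2[symmetric] suminf_geometric summable_geometric summable_mult2)
    finally show ?thesis using T_bd[OF z, of x] by (simp add: algebra_simps)
  qed
  have radial: "(\<Sum>k<K. (norm (of_real r ^ k *\<^sub>C h k))\<^sup>2) \<le> A" if r: "0 < r" "r < 1" for r :: real
  proof -
    have "(\<Sum>k<K. (norm (of_real r ^ k *\<^sub>C h k))\<^sup>2) \<le> (1 + r ^ n / (1 - r))\<^sup>2 * A" if n: "K \<le> n" for n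
    proof (cases "K = 0")
      case True
      then show ?thesis by (simp add: A_def)
    next
      case False
      \<comment> \<open>The product of polynomials of degrees below \<open>n\<close> and below
        \<open>K\<close> has degree below \<open>m\<close>, so \<open>m\<close> sample points make
        Parseval exact.\<close>
      define m where "m = n + K"
      define \<omega> where "\<omega> = cis (2 * pi / real m)"
      \<comment> \<open>Zero padding makes \<open>c\<close> the full convolution of the truncated
        sequences; it agrees with \<open>h\<close> below \<open>K\<close> because \<open>n\<close>
        is at least \<open>K\<close>.\<close>
      define g where "g i j = (if i < n \<and> j < K then t i (f j) else 0)" for i j
      define c where "c k = (\<Sum>i\<le>k. g i (k - i))" for k
      define p where "p z = (\<Sum>j<K. z ^ j *\<^sub>C f j)" for z
      define B where "B = 1 + r ^ n / (1 - r)"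
      have B0: "0 \<le> B" using r by (simp add: B_def)
      have m0: "0 < m" using False by (simp add: m_def)
      have c_h: "c k = h k" if "k < K" for k
        unfolding c_def h_def by (rule sum.cong) (use that n in \<open>auto simp: g_def\<close>)
      have c_p: "(\<Sum>k<m. z ^ k *\<^sub>C c k) = (\<Sum>i<n. z ^ i *\<^sub>C t i (p z))" for z
      proof -
        have "(\<Sum>k<m. z ^ k *\<^sub>C c k) = (\<Sum>k<m. \<Sum>i\<le>k. z ^ (i + (k - i)) *\<^sub>C g i (k - i))"
          by (simp add: c_def linear_sum[OF bounded_linear.linear[OF bounded_linear_scaleC_right]])
        also have "\<dots> = (\<Sum>(i, j)\<in>{(i, j). i + j < m}. z ^ (i + j) *\<^sub>C g i j)"
          by (rule sum.triangle_reindex[symmetric])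
        also have "\<dots> = (\<Sum>(i, j)\<in>{..<n} \<times> {..<K}. z ^ (i + j) *\<^sub>C g i j)"
        proof (rule sum.mono_neutral_right)
          show "finite {(i, j). i + j < m}"
            by (rule finite_subset[of _ "{..<m} \<times> {..<m}"]) auto
        qed (auto simp: g_def m_def split: if_splits)
        also have "\<dots> = (\<Sum>i<n. \<Sum>j<K. z ^ (i + j) *\<^sub>C g i j)" by (simp add: sum.cartesian_product)
        also have "\<dots> = (\<Sum>i<n. z ^ i *\<^sub>C t i (p z))"
          by (intro sum.cong refl)
            (simp add: p_def g_def clinear_sum[OF lin] clinear_scaleC[OF lin] power_add
              linear_sum[OF bounded_linear.linear[OF bounded_linear_scaleC_right]])
        finally show ?thesis .
      qed
      define z where "z j = of_real r * \<omega> ^ j" for j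
      have nz: "norm (z j) = r" for j using r by (simp add: z_def norm_mult norm_power \<omega>_def)
      have "real m * (\<Sum>k<K. (norm (of_real r ^ k *\<^sub>C h k))\<^sup>2) = real m * (\<Sum>k<K. (norm (of_real r ^ k *\<^sub>C c k))\<^sup>2)"
        by (simp add: c_h)
      also have "\<dots> \<le> real m * (\<Sum>k<m. (norm (of_real r ^ k *\<^sub>C c k))\<^sup>2)"
        by (intro mult_left_mono sum_mono2) (auto simp: m_def)
      also have "\<dots> = (\<Sum>j<m. (norm (\<Sum>k<m. (\<omega> ^ j) ^ k *\<^sub>C of_real r ^ k *\<^sub>C c k))\<^sup>2)"
        unfolding \<omega>_def by (rule discrete_Parseval[symmetric])
      also have "\<dots> = (\<Sum>j<m. (norm (\<Sum>k<m. z j ^ k *\<^sub>C c k))\<^sup>2)"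
        by (simp add: z_def power_mult_distrib mult.commute)
      also have "\<dots> \<le> (\<Sum>j<m. (B * norm (p (z j)))\<^sup>2)"
      proof (intro sum_mono power_mono)
        show "norm (\<Sum>k<m. z j ^ k *\<^sub>C c k) \<le> B * norm (p (z j))" for j
          using trunc[where z = "z j" and n = n and x = "p (z j)"] r by (simp add: c_p nz B_def)
      qed simp
      also have "\<dots> = B\<^sup>2 * (\<Sum>j<m. (norm (p (z j)))\<^sup>2)"
        by (simp add: power_mult_distrib sum_distrib_left)
      \<comment> \<open>Padding with zeros up to \<open>m\<close> coefficients allows Parseval to be
        used in the other direction, for the input polynomial.\<close>
      also have "(\<Sum>j<m. (norm (p (z j)))\<^sup>2) =
          (\<Sum>j<m. (norm (\<Sum>k<m. (\<omega> ^ j) ^ k *\<^sub>C (if k < K then of_real r ^ k *\<^sub>C f k else 0)))\<^sup>2)"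
      proof (intro sum.cong refl arg_cong[where f = "\<lambda>x. (norm x)\<^sup>2"])
        fix j
        have "p (z j) = (\<Sum>k<K. (\<omega> ^ j) ^ k *\<^sub>C (if k < K then of_real r ^ k *\<^sub>C f k else 0))"
          unfolding p_def by (intro sum.cong refl) (simp add: z_def power_mult_distrib mult.commute)
        also have "\<dots> = (\<Sum>k<m. (\<omega> ^ j) ^ k *\<^sub>C (if k < K then of_real r ^ k *\<^sub>C f k else 0))"
          by (intro sum.mono_neutral_left) (auto simp: m_def)
        finally show "p (z j) = (\<Sum>k<m. (\<omega> ^ j) ^ k *\<^sub>C (if k < K then of_real r ^ k *\<^sub>C f k else 0))" .
      qed
      also have "\<dots> = real m * (\<Sum>k<m. (norm (if k < K then of_real r ^ k *\<^sub>C f k else 0))\<^sup>2)"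
        unfolding \<omega>_def by (rule discrete_Parseval)
      also have "(\<Sum>k<m. (norm (if k < K then of_real r ^ k *\<^sub>C f k else 0))\<^sup>2) =
          (\<Sum>k<K. (norm (if k < K then of_real r ^ k *\<^sub>C f k else 0))\<^sup>2)"
        by (intro sum.mono_neutral_right) (auto simp: m_def)
      also have "\<dots> \<le> A"
        unfolding A_def
      proof (intro sum_mono power_mono)
        show "norm (if k < K then of_real r ^ k *\<^sub>C f k else 0) \<le> norm (f k)" for k
          using r power_le_one[of r k] by (simp add: norm_power mult_left_le_one_le)
      qed simp
      finally have "real m * (\<Sum>k<K. (norm (of_real r ^ k *\<^sub>C h k))\<^sup>2) \<le> real m * (B\<^sup>2 * A)"
        by (simp add: mult_left_mono mult.left_commute)
      with m0 show ?thesis by (simp add: B_def)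
    qed
    note bound = this
    show ?thesis
    proof (rule LIMSEQ_le_const)
      have "(\<lambda>n. (1 + r ^ n / (1 - r))\<^sup>2 * A) \<longlonglongrightarrow> (1 + 0 / (1 - r))\<^sup>2 * A"
        using r by (intro tendsto_intros LIMSEQ_realpow_zero) auto
      then show "(\<lambda>n. (1 + r ^ n / (1 - r))\<^sup>2 * A) \<longlonglongrightarrow> A" by simp
    qed (use bound in blast)
  qed
  have "((\<lambda>r::real. \<Sum>k<K. (norm (complex_of_real r ^ k *\<^sub>C h k))\<^sup>2) \<longlongrightarrow>
      (\<Sum>k<K. (norm (h k))\<^sup>2)) (at_left 1)"
  proof (rule tendsto_sum)
    fix k
    have "((\<lambda>r::real. (norm (complex_of_real r ^ k) * norm (h k))\<^sup>2) \<longlongrightarrow>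
        (norm (complex_of_real 1 ^ k) * norm (h k))\<^sup>2) (at_left 1)"
      by (intro tendsto_intros)
    then show "((\<lambda>r::real. (norm (complex_of_real r ^ k *\<^sub>C h k))\<^sup>2) \<longlongrightarrow> (norm (h k))\<^sup>2) (at_left 1)"
      by simp
  qed
  moreover have "\<forall>\<^sub>F r in at_left (1::real). r \<in> {0<..<1}" by (rule eventually_at_left_real) simp
  then have "\<forall>\<^sub>F r in at_left (1::real). (\<Sum>k<K. (norm (complex_of_real r ^ k *\<^sub>C h k))\<^sup>2) \<le> A"
    by eventually_elim (use radial in auto)
  ultimately have "(\<Sum>k<K. (norm (h k))\<^sup>2) \<le> A" by (rule tendsto_upperbound) simp
  then show ?thesis by (simp add: h_def A_def)
qed

section \<open>Weights and summability for multiplication by \<open>Psi\<close>\<close>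

lemma sum_gamma_inv: "(\<Sum>j\<le>k. gamma_inv \<beta> j) = inverse (\<beta> k)" if "weight_sequence \<beta>"
  by (induction k) (use that in \<open>simp_all add: gamma_inv_def weight_sequence_def\<close>)

text \<open>Supplies the majorant that \<open>operator_Cauchy_product\<close> needs for the
  coefficients of \<open>Psi\<close>, from sqrt x <= 1 + x and
  \<open>gamma_inv \<beta> j \<le> 1 / \<beta> j\<close>.\<close>

lemma summable_power_sqrt_gamma_inv:
  assumes ws: "weight_sequence \<beta>" and dec: "decseq \<beta>" and z: "norm z < 1"
  shows "summable (\<lambda>j. norm z ^ j * sqrt (gamma_inv \<beta> j))"
proof -
  \<comment> \<open>\<open>summable_power_div_weight\<close> involves even powers; the square root
    turns them into plain powers of |z|.\<close>
  define s where "s = sqrt (norm z)"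
  have s: "0 \<le> s" "s < 1" "s ^ j * s ^ j = norm z ^ j" for j
    using z by (auto simp: s_def simp flip: power_mult_distrib)
  have "summable (\<lambda>j. norm s ^ (2 * j) / \<beta> j)" by (rule summable_power_div_weight[OF ws]) (use s in auto)
  then have s1: "summable (\<lambda>j. norm z ^ j / \<beta> j)" using s by (simp add: power_mult power2_eq_square power_mult_distrib)
  have "summable (\<lambda>j. norm z ^ j + norm z ^ j / \<beta> j)"
    by (rule summable_add[OF _ s1]) (use z in \<open>simp add: summable_geometric\<close>)
  moreover have "norm (norm z ^ j * sqrt (gamma_inv \<beta> j)) \<le> norm z ^ j + norm z ^ j / \<beta> j" for j
  proof -
    note w = weight_decseq_bounds[OF ws dec]
    have "gamma_inv \<beta> j \<le> 1 / \<beta> j"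
      using w(1)[of "j - 1"] w(1)[of j] ws
      by (auto simp: gamma_inv_def weight_sequence_def inverse_eq_divide intro: less_imp_le)
    moreover have "sqrt x \<le> 1 + x" if "0 \<le> x" for x :: real
    proof -
      have "x \<le> (1 + x)\<^sup>2" using that by (simp add: power2_eq_square algebra_simps)
      then show ?thesis using real_sqrt_le_mono[of x "(1 + x)\<^sup>2"] that by simp
    qed
    ultimately have "sqrt (gamma_inv \<beta> j) \<le> 1 + 1 / \<beta> j" using w(4)[of j] by (meson add_left_mono order_trans)
    then have "norm z ^ j * sqrt (gamma_inv \<beta> j) \<le> norm z ^ j * (1 + 1 / \<beta> j)" by (rule mult_left_mono) simp
    then show ?thesis using w(4)[of j] by (simp add: distrib_left)
  qed
  ultimately show ?thesis by (rule summable_comparison_test'[where N = 0]) 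
qed

lemma schur_imp_contractive_multiplier:
  fixes S :: "complex \<Rightarrow> 'u::chilbert_space \<Rightarrow>\<^sub>C\<^sub>L 'y::chilbert_space"
    and T :: "complex \<Rightarrow> 'u \<Rightarrow>\<^sub>C\<^sub>L 'y ell2"
  assumes ws: "weight_sequence \<beta>" and dec: "decseq \<beta>"
    and T: "T \<in> schur_class" and S: "\<And>z. z \<in> ball 0 1 \<Longrightarrow> S z = Psi \<beta> z o\<^sub>C\<^sub>L T z"
  shows "S \<in> contractive_multipliers \<beta>"
  unfolding contractive_multipliers_def
proof (intro CollectI ballI)
  fix f :: "nat \<Rightarrow> 'u" assume f: "f \<in> hardy"
  note wt = weight_decseq_bounds[OF ws dec]
  obtain t where lin: "\<And>k. clinear (t k)" and t_bd: "\<And>k u. norm (t k u) \<le> norm u"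
    and t: "\<And>z u. norm z < 1 \<Longrightarrow> (\<lambda>k. z ^ k *\<^sub>C t k u) sums cblinfun_apply (T z) u"
    by (rule schur_class_power_series[OF T]) blast
  have T_bd: "norm (cblinfun_apply (T z) u) \<le> norm u" if "norm z < 1" for z u
    using norm_cblinfun_apply_le[of "T z" u] mult_right_mono[of "norm (T z)" 1 "norm u"] T that
    by (auto simp: schur_class_def intro: order_trans)
  have sf: "summable (\<lambda>k. (norm (f k))\<^sup>2)" using f by (simp add: whardy_def)
  define f' where "f' = Ell2 f"
  have f': "ell2_nth f' = f" unfolding f'_def by (rule ell2_nth_Ell2[OF sf])
  have fs: "(\<lambda>k. z ^ k *\<^sub>C f k) sums ps_eval f z" if "norm z < 1" for z
    using ps_eval_sums[OF ws ell2_in_whardy[OF ws dec, of f'], of z] that by (simp add: f')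
  define h where "h k = (\<Sum>i\<le>k. t i (f (k - i)))" for k
  have h: "(\<lambda>k. z ^ k *\<^sub>C h k) sums cblinfun_apply (T z) (ps_eval f z)" if z: "norm z < 1" for z
    using operator_Cauchy_product[of t "\<lambda>_. 1", OF lin _ _ _ fs[OF z]] t[OF z, of "ps_eval f z"] z
    by (simp add: t_bd summable_geometric h_def[abs_def] sums_iff)
  have h_bd: "(\<Sum>k<n. (norm (h k))\<^sup>2) \<le> (\<Sum>k. (norm (f k))\<^sup>2)" for n
    unfolding h_def
    by (rule order_trans[OF lower_triangular_Toeplitz_contraction[OF lin t_bd t T_bd] sum_le_suminf[OF sf]]) auto
  \<comment> \<open>The Taylor coefficients of \<open>Psi\<close> as operators, so that
    \<open>g\<close> below is the coefficient sequence of Psi T f.\<close>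
  define L where "L j x = complex_of_real (sqrt (gamma_inv \<beta> j)) *\<^sub>C ell2_nth x j" for j and x :: "'y ell2"
  have L: "clinear (L j)" for j
    by (simp add: clinear_def L_def plus_ell2.rep_eq scaleC_ell2.rep_eq scaleC_add_right mult.commute)
  have L_bd: "norm (L j x) \<le> sqrt (gamma_inv \<beta> j) * norm x" for j x
    using norm_ell2_nth_le[of x j] wt(4)[of j] by (simp add: L_def mult_left_mono)
  define g where "g k = (\<Sum>j\<le>k. L j (h (k - j)))" for k
  have gS: "ps_eval g z = cblinfun_apply (S z) (ps_eval f z)" if "z \<in> ball 0 1" for z
  proof -
    have z: "norm z < 1" using that by simp
    have "(\<lambda>k. z ^ k *\<^sub>C g k) sums (\<Sum>j. z ^ j *\<^sub>C L j (cblinfun_apply (T z) (ps_eval f z)))"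
      unfolding g_def
      by (rule operator_Cauchy_product[OF L L_bd _ _ h[OF z]])
        (use wt(4) summable_power_sqrt_gamma_inv[OF ws dec z] in auto)
    then show ?thesis
      using Psi_apply[OF ws dec that, of "cblinfun_apply (T z) (ps_eval f z)"]
      by (simp add: ps_eval_def L_def S[OF that] cblinfun_compose.rep_eq sums_iff)
  qed
  have g_k: "\<beta> k * (norm (g k))\<^sup>2 \<le> (\<Sum>j\<le>k. (norm (ell2_nth (h (k - j)) j))\<^sup>2)" for k
  proof -
    have "norm (g k) \<le> (\<Sum>j\<le>k. norm (L j (h (k - j))))" unfolding g_def by (rule norm_sum)
    also have "\<dots> = (\<Sum>j\<le>k. sqrt (gamma_inv \<beta> j) * norm (ell2_nth (h (k - j)) j))"
      using wt(4) by (simp add: L_def)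
    finally have "(norm (g k))\<^sup>2 \<le> (\<Sum>j\<le>k. sqrt (gamma_inv \<beta> j) * norm (ell2_nth (h (k - j)) j))\<^sup>2"
      by (rule power_mono) simp
    \<comment> \<open>Cauchy-Schwarz loses exactly the factor \<open>inverse (\<beta> k)\<close>,
      which the weight in the target norm compensates.\<close>
    also have "\<dots> \<le> (\<Sum>j\<le>k. (sqrt (gamma_inv \<beta> j))\<^sup>2) * (\<Sum>j\<le>k. (norm (ell2_nth (h (k - j)) j))\<^sup>2)"
      by (rule Cauchy_Schwarz_ineq_sum)
    also have "(\<Sum>j\<le>k. (sqrt (gamma_inv \<beta> j))\<^sup>2) = inverse (\<beta> k)"
      using wt(4) by (simp add: sum_gamma_inv[OF ws])
    finally show ?thesis using wt(1)[of k] by (simp add: field_simps)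
  qed
  have g_bd: "(\<Sum>k<n. \<beta> k * (norm (g k))\<^sup>2) \<le> (\<Sum>k. (norm (f k))\<^sup>2)" for n
  proof -
    have "(\<Sum>k<n. \<beta> k * (norm (g k))\<^sup>2) \<le> (\<Sum>k<n. \<Sum>j\<le>k. (norm (ell2_nth (h (k - j)) j))\<^sup>2)"
      by (intro sum_mono g_k)
    \<comment> \<open>Entry j of \<open>h m\<close> occurs only in the estimate for index j + m, so
      every entry is counted at most once and the triangle can be enlarged to a square.\<close>
    also have "\<dots> = (\<Sum>(j, m)\<in>{(j, m). j + m < n}. (norm (ell2_nth (h m) j))\<^sup>2)"
      by (rule sum.triangle_reindex[symmetric])
    also have "\<dots> \<le> (\<Sum>(j, m)\<in>{..<n} \<times> {..<n}. (norm (ell2_nth (h m) j))\<^sup>2)"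
      by (rule sum_mono2) auto
    also have "\<dots> = (\<Sum>m<n. \<Sum>j<n. (norm (ell2_nth (h m) j))\<^sup>2)"
      unfolding sum.cartesian_product[symmetric] by (rule sum.swap)
    also have "\<dots> \<le> (\<Sum>m<n. (norm (h m))\<^sup>2)" by (intro sum_mono sum_sq_le_norm_ell2)
    also have "\<dots> \<le> (\<Sum>k. (norm (f k))\<^sup>2)" by (rule h_bd)
    finally show ?thesis .
  qed
  have sg: "summable (\<lambda>k. \<beta> k * (norm (g k))\<^sup>2)"
    by (rule summableI_nonneg_bounded[OF _ g_bd]) (use wt(1) in \<open>simp add: less_imp_le\<close>)
  show "\<exists>g\<in>whardy \<beta>. (\<forall>z\<in>ball 0 1. ps_eval g z = cblinfun_apply (S z) (ps_eval f z)) \<and>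
      whardy_norm \<beta> g \<le> hardy_norm f"
  proof (intro bexI[where x = g] conjI ballI gS)
    show "g \<in> whardy \<beta>" using sg by (simp add: whardy_def)
    show "whardy_norm \<beta> g \<le> hardy_norm f"
      using suminf_le_const[OF sg g_bd] by (simp add: whardy_norm_def)
  qed
qed

theorem theorem2p1:
  fixes \<beta> :: "nat \<Rightarrow> real"
    and S :: "complex \<Rightarrow> 'u::chilbert_space \<Rightarrow>\<^sub>C\<^sub>L 'y::chilbert_space"
  assumes "weight_sequence \<beta>" and "decseq \<beta>"
  shows "S \<in> contractive_multipliers \<beta> \<longleftrightarrow>
    (\<exists>T :: complex \<Rightarrow> 'u \<Rightarrow>\<^sub>C\<^sub>L 'y ell2.
       T \<in> schur_class \<and> (\<forall>z\<in>ball 0 1. S z = Psi \<beta> z o\<^sub>C\<^sub>L T z))"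
  using contractive_multiplier_imp_schur[OF assms] schur_imp_contractive_multiplier[OF assms] by blast

end
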